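(* For each ordered pair $(b,c)\in\{(1,3),(2,3),(2,6),(3,3),(3,4),(3,9)\}$, every nonnegative integer $n$ can be written as $n=p_5(x)+b\,p_5(y)+c\,p_5(z)$ for some integers $x,y,z\in\mathbb{Z}$, where $p_5(t)=\frac{3t^2-t}{2}$.
   Context: For an integer $m\geq 3$ and $x\in\mathbb{Z}$, $p_m(x)=(m-2)\frac{x(x-1)}{2}+x$; values $p_m(x)$ with $x\in\mathbb{Z}$ are called generalized $m$-gonal numbers. In particular $p_5(x)=\frac{3x^2-x}{2}$. A sum $a p_i+b p_j+c p_k$ (with $a,b,c$ positive integers) is called universal over $\mathbb{Z}$ if every $n\in\{0,1,2,\dots\}$ equals $a p_i(x)+b p_j(y)+c p_k(z)$ for some $x,y,z\in\mathbb{Z}$. *)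

theory Defs
  imports Complex_Main
begin

(* x * (x - 1) is always even, so the integer division is exact. *)
definition polygonal :: "nat \<Rightarrow> int \<Rightarrow> int" where
  "polygonal m x = (int m - 2) * (x * (x - 1) div 2) + x"

lemma real_polygonal:
  "real_of_int (polygonal m x) = (real m - 2) * (real_of_int x * (real_of_int x - 1) / 2) + real_of_int x"
proof -
  have "even (x * (x - 1))" by simp
  then show ?thesis
    by (simp add: polygonal_def real_of_int_div)
qed

lemma real_polygonal_5:
  "real_of_int (polygonal 5 t) = (3 * real_of_int t ^ 2 - real_of_int t) / 2"
  by (simp add: real_polygonal power2_eq_square field_simps)

end

theory Submission
  imports Defs "HOL-Number_Theory.Number_Theory" "HOL-Analysis.Summation_Tests"
    "HOL-Computational_Algebra.Squarefree"
begin

text \<open>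
  Since \<open>24 p\<^sub>5(x) + 1 = (6x - 1)\<^sup>2\<close>, one has to represent \<open>24n + 1 + b + c\<close> by
  \<open>u\<^sup>2 + b v\<^sup>2 + c w\<^sup>2\<close> with \<open>u, v, w\<close> prime to \<open>6\<close>. All six forms reduce to
  \<open>x\<^sup>2 + y\<^sup>2 + z\<^sup>2\<close> and \<open>x\<^sup>2 + y\<^sup>2 + y z + z\<^sup>2\<close>, the latter representing the same numbers as
  \<open>x\<^sup>2 + y\<^sup>2 + 3 z\<^sup>2\<close>; primality to \<open>6\<close> is then arranged by reflections and by units of the
  Eisenstein integers.

  For both forms the Davenport--Cassels descent makes rational representations integral. A
  rational representation of a squarefree \<open>N\<close> comes from solving \<open>N X\<^sup>2 = Z\<^sup>2 + t Y\<^sup>2\<close> by the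
  pigeonhole principle, where \<open>t\<close> is a prime \<open>q\<close>, \<open>2q\<close> or \<open>3q\<close> such that a multiple of \<open>t\<close> by a
  nonzero square is a value of the remaining binary form, \<open>- t\<close> is a square modulo \<open>N\<close> and,
  by quadratic reciprocity, \<open>N\<close> is a square modulo \<open>t\<close>. These conditions prescribe \<open>q\<close> modulo
  \<open>8\<close> and its Legendre symbols at finitely many primes. Such a \<open>q\<close> exists by the argument of
  Dirichlet, Mertens and Shapiro, which here needs \<open>L(1, \<chi>) \<noteq> 0\<close> for real characters \<open>\<chi>\<close> only.
\<close>

section \<open>Sums over real characters\<close>

text \<open>All conditions on the auxiliary prime q are quadratic, so expanding their indicator
  produces only products of real characters; complex characters never arise. The form x^2 + y^2 + 3
  z^2 cannot be descended directly: at the centre of a lattice cell it takes the value 5/4, above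
  the bound 1 that Davenport--Cassels requires, hence the passage to x^2 + y^2 + y z + z^2. That
  form omits exactly the numbers 9^a (9 b + 6), and the sum of three squares omits exactly 4^a (8 b
  + 7). The targets avoid these classes: 24n + 5, 24n + 13 and, from 24n + 8 = 4 (6n + 2), the
  number 6n + 2 are prime to 3; 3 (24n + 7) is 3 modulo 9; 24n + 6 = 6 (4n + 1) and 24n + 9 = 3 (8n
  + 3) lead to three squares with sum 4n + 1 or 8n + 3.\<close>

lemma abel_sum_bound:
  fixes u f :: "nat \<Rightarrow> real"
  assumes u: "\<And>k. \<bar>\<Sum>n=a..<k. u n\<bar> \<le> B"
    and decr: "\<And>n. n \<ge> a \<Longrightarrow> f (Suc n) \<le> f n" and nonneg: "\<And>n. n \<ge> a \<Longrightarrow> 0 \<le> f n"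
  shows "\<bar>\<Sum>n=a..<b. u n * f n\<bar> \<le> B * f a"
proof (cases "a \<le> b")
  case False
  have "0 \<le> B" using u[of a] by simp
  thus ?thesis using False nonneg[of a] by simp
next
  case True
  define S where "S k = (\<Sum>n=a..<k. u n)" for k
  have B: "0 \<le> B" using u[of a] by simp
  have S: "\<bar>S k\<bar> \<le> B" for k using u by (simp add: S_def)
  have eq: "(\<Sum>n=a..<b. u n * f n) = S b * f b + (\<Sum>k=a..<b. S (Suc k) * (f k - f (Suc k)))"
    using True
  proof (induction b rule: dec_induct)
    case (step n)
    have "S (Suc n) = S n + u n" using step by (simp add: S_def)
    thus ?case using step by (simp add: algebra_simps)
  qed (simp add: S_def)
  have "\<bar>\<Sum>n=a..<b. u n * f n\<bar> \<le> \<bar>S b * f b\<bar> + (\<Sum>k=a..<b. \<bar>S (Suc k) * (f k - f (Suc k))\<bar>)"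
    unfolding eq using sum_abs[of "\<lambda>k. S (Suc k) * (f k - f (Suc k))" "{a..<b}"] by linarith
  also have "\<dots> \<le> B * f b + (\<Sum>k=a..<b. B * (f k - f (Suc k)))"
    using S decr nonneg True B
    by (intro add_mono sum_mono) (auto simp: abs_mult intro!: mult_mono)
  also have "(\<Sum>k=a..<b. B * (f k - f (Suc k))) = B * (f a - f b)"
    using sum_Suc_diff'[OF True, of f]
    by (simp add: sum_distrib_left[symmetric] sum_subtractf)
  finally show ?thesis by (simp add: algebra_simps)
qed

section \<open>Chebyshev and Mertens estimates for the von Mangoldt function\<close>

lemma sum_divisors_hyperbola:
  fixes F :: "nat \<Rightarrow> nat \<Rightarrow> 'a :: comm_monoid_add"
  shows "(\<Sum>n=1..x. \<Sum>d | d dvd n. F d (n div d)) = (\<Sum>d=1..x. \<Sum>m=1..x div d. F d m)"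
proof -
  have "(\<Sum>n=1..x. \<Sum>d | d dvd n. F d (n div d)) =
      (\<Sum>(n,d)\<in>(SIGMA n:{1..x}. {d. d dvd n}). F d (n div d))"
    by (subst sum.Sigma) auto
  also have "\<dots> = (\<Sum>(d,m)\<in>(SIGMA d:{1..x}. {1..x div d}). F d m)"
  proof (rule sum.reindex_bij_witness[where i = "\<lambda>(d, m). (d * m, d)" and j = "\<lambda>(n, d). (d, n div d)"])
    fix a assume a: "a \<in> (SIGMA n:{1..x}. {d. d dvd n})"
    obtain n d where "a = (n, d)" by (cases a)
    then obtain m where [simp]: "a = (d * m, d)" and *: "1 \<le> d * m" "d * m \<le> x" using a by auto
    have "d \<ge> 1" "m \<ge> 1" using *(1) by (cases d; cases m; simp)+
    moreover have "d \<le> x" using \<open>m \<ge> 1\<close> *(2) by (metis dual_order.trans mult.commute mult_le_mono1 mult_1)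
    moreover have "m \<le> x div d" using \<open>d \<ge> 1\<close> *(2) by (simp add: less_eq_div_iff_mult_less_eq mult.commute)
    ultimately show "(case a of (n, d) \<Rightarrow> (d, n div d)) \<in> (SIGMA d:{1..x}. {1..x div d})"
      "(case (case a of (n, d) \<Rightarrow> (d, n div d)) of (d, m) \<Rightarrow> (d * m, d)) = a"
      "(case (case a of (n, d) \<Rightarrow> (d, n div d)) of (d, m) \<Rightarrow> F d m) = (case a of (n, d) \<Rightarrow> F d (n div d))"
      by auto
  next
    fix b assume b: "b \<in> (SIGMA d:{1..x}. {1..x div d})"
    obtain d m where [simp]: "b = (d, m)" by (cases b)
    have *: "1 \<le> d" "1 \<le> m" "m \<le> x div d" using b by auto
    hence "d * m \<le> x" by (simp add: less_eq_div_iff_mult_less_eq mult.commute)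
    thus "(case b of (d, m) \<Rightarrow> (d * m, d)) \<in> (SIGMA n:{1..x}. {d. d dvd n})"
      "(case (case b of (d, m) \<Rightarrow> (d * m, d)) of (n, d) \<Rightarrow> (d, n div d)) = b"
      using * by auto
  qed
  also have "\<dots> = (\<Sum>d=1..x. \<Sum>m=1..x div d. F d m)"
    by (subst sum.Sigma) auto
  finally show ?thesis .
qed

text \<open>\<open>ln\<close> is the divisor sum of \<open>mangoldt\<close>, and
  \<open>n div d\<close> counts the multiples of d up to n.\<close>

lemma ln_fact_eq_sum_mangoldt:
  "ln (fact n :: real) = (\<Sum>d=1..n. mangoldt d * real (n div d))"
proof -
  have "ln (fact n :: real) = (\<Sum>k=1..n. ln (real k))"
    unfolding fact_prod of_nat_prod by (subst ln_prod) auto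
  also have "\<dots> = (\<Sum>k=1..n. \<Sum>d | d dvd k. mangoldt d)"
    by (intro sum.cong) (auto simp: mangoldt_sum)
  also have "\<dots> = (\<Sum>d=1..n. mangoldt d * real (n div d))"
    using sum_divisors_hyperbola[of "\<lambda>d _. mangoldt d :: real"] by (simp add: mult.commute)
  finally show ?thesis .
qed

text \<open>Bisection: the weight \<open>2*k div d - 2 * (k div d)\<close> is nonnegative and at
  least 1 for k < d \<le> 2k, so the sum over the upper half is at most the logarithm of the central
  binomial coefficient, hence at most 2k ln 2.\<close>

lemma chebyshev_psi_le: "(\<Sum>d=1..n. mangoldt d :: real) \<le> 4 * real n"
proof (induction n rule: less_induct)
  case (less n)
  define k where "k = n div 2"
  show ?case
  proof (cases "n = 0")
    case False
    hence k: "k < n" by (simp add: k_def)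
    have "(\<Sum>d=1..2*k. mangoldt d :: real) - (\<Sum>d=1..k. mangoldt d)
        = (\<Sum>d=k+1..2*k. mangoldt d)"
    proof -
      have "{1..2*k} = {1..k} \<union> {k+1..2*k}" by auto
      hence "(\<Sum>d=1..2*k. mangoldt d :: real) = (\<Sum>d=1..k. mangoldt d) + (\<Sum>d=k+1..2*k. mangoldt d)"
        by (metis (no_types, lifting) finite_atLeastAtMost ivl_disj_int_two(8) sum.union_disjoint
            Suc_eq_plus1 atLeastSucAtMost_greaterThanAtMost)
      thus ?thesis by simp
    qed
    also have "\<dots> \<le> (\<Sum>d=k+1..2*k. mangoldt d * (real (2*k div d) - 2 * real (k div d)))"
    proof (rule sum_mono)
      fix d assume d: "d \<in> {k+1..2*k}"
      hence "k div d = 0" "1 \<le> 2 * k div d" by (auto simp: less_eq_div_iff_mult_less_eq)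
      hence "1 \<le> real (2*k div d) - 2 * real (k div d)" by simp
      thus "(mangoldt d :: real) \<le> mangoldt d * (real (2*k div d) - 2 * real (k div d))"
        using mangoldt_nonneg[of d] by (simp add: mult_le_cancel_left1)
    qed
    also have "\<dots> \<le> (\<Sum>d=1..2*k. mangoldt d * (real (2*k div d) - 2 * real (k div d)))"
    proof (intro sum_mono2 mult_nonneg_nonneg mangoldt_nonneg)
      fix d assume "d \<in> {1..2*k} - {k+1..2*k}"
      hence d: "d > 0" by auto
      have "2 * (k div d) \<le> 2 * k div d"
        using d div_times_less_eq_dividend[of k d] by (simp add: less_eq_div_iff_mult_less_eq)
      thus "0 \<le> real (2*k div d) - 2 * real (k div d)" by linarith
    qed auto
    also have "\<dots> = (\<Sum>d=1..2*k. mangoldt d * real (2*k div d)) - 2 * (\<Sum>d=1..2*k. mangoldt d * real (k div d))"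
      by (simp add: sum_subtractf sum_distrib_left algebra_simps)
    also have "(\<Sum>d=1..2*k. mangoldt d * real (k div d)) = (\<Sum>d=1..k. mangoldt d * real (k div d))"
      by (intro sum.mono_neutral_right) auto
    also have "(\<Sum>d=1..2*k. mangoldt d * real (2*k div d)) - 2 * (\<Sum>d=1..k. mangoldt d * real (k div d))
        = ln (fact (2*k)) - 2 * ln (fact k)"
      by (simp add: ln_fact_eq_sum_mangoldt)
    also have "\<dots> = ln (real ((2*k) choose k))"
    proof -
      have "real ((2*k) choose k) = fact (2*k) / (fact k * fact k)"
        using binomial_fact[of k "2*k", where 'a = real] by simp
      thus ?thesis
        using ln_div[of "fact (2*k) :: real" "fact k * fact k"] ln_mult[of "fact k :: real" "fact k"] by simp
    qed
    also have "\<dots> \<le> ln (2 ^ (2*k))"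
    proof -
      have "real (2*k choose k) \<le> real (2 ^ (2*k))" using binomial_le_pow2 of_nat_le_iff by blast
      moreover have "0 < real (2*k choose k)" by simp
      ultimately show ?thesis by (subst ln_le_cancel_iff) simp_all
    qed
    also have "\<dots> = 2 * real k * ln 2" by (simp add: ln_realpow)
    also have "\<dots> \<le> 2 * real k * 1" using ln_le_minus_one[of "2::real"] by (intro mult_left_mono) auto
    \<comment> \<open>The induction hypothesis contributes 4k and the binomial coefficient 2k. An
      odd n adds one more term, at most ln (2k + 1) \<le> 2k, and 8k is still below 4n.\<close>
    finally have "(\<Sum>d=1..2*k. mangoldt d :: real) \<le> 6 * real k"
      using less.IH[OF k] by simp
    moreover have "n = 2 * k \<or> n = Suc (2 * k)" unfolding k_def by presburger
    moreover have "(mangoldt (Suc (2*k)) :: real) \<le> 2 * real k"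
      using mangoldt_le[of "Suc (2*k)"] ln_le_minus_one[of "real (Suc (2*k))"] by simp
    ultimately show ?thesis by (elim disjE) simp_all
  qed simp
qed

text \<open>The lower half of Mertens' first theorem, from ln n! \<ge> n ln n - n and
  \<open>x div d\<close> \<le> x / d.\<close>

lemma ln_le_sum_mangoldt:
  assumes "x > 0"
  shows "ln (real x) - 1 \<le> (\<Sum>d=1..x. mangoldt d / real d)"
proof -
  have fact: "real n * ln (real n) - real n \<le> ln (fact n)" for n
  proof (induction n)
    case (Suc n)
    show ?case
    proof (cases "n = 0")
      case False
      have "real (Suc n) / real n = 1 + 1 / real n" using False by (simp add: field_simps)
      hence "ln (real (Suc n)) - ln (real n) = ln (1 + 1 / real n)"
        using False ln_div[of "real (Suc n)" "real n"] by simp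
      also have "\<dots> \<le> 1 / real n" by (intro ln_add_one_self_le_self) simp
      finally have "real n * (ln (real (Suc n)) - ln (real n)) \<le> 1" using False by (simp add: field_simps)
      moreover have "ln (fact (Suc n) :: real) = ln (real (Suc n)) + ln (fact n)"
        unfolding fact_Suc of_nat_mult by (subst ln_mult) auto
      ultimately show ?thesis using Suc.IH by (simp add: algebra_simps)
    qed simp
  qed simp
  have "real x * ln (real x) - real x \<le> (\<Sum>d=1..x. mangoldt d * real (x div d))"
    using fact[of x] by (simp add: ln_fact_eq_sum_mangoldt)
  also have "\<dots> \<le> (\<Sum>d=1..x. mangoldt d * (real x / real d))"
    by (intro sum_mono mult_left_mono mangoldt_nonneg) (simp add: of_nat_div_le_of_nat)
  also have "\<dots> = real x * (\<Sum>d=1..x. mangoldt d / real d)"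
    by (simp add: sum_distrib_left mult_ac)
  finally have "real x * (ln (real x) - 1) \<le> real x * (\<Sum>d=1..x. mangoldt d / real d)"
    by (simp add: algebra_simps)
  thus ?thesis using assms by simp
qed

lemma sum_divisors_prime_power_mult:
  fixes f :: "nat \<Rightarrow> 'a :: comm_monoid_add"
  assumes p: "prime p" and m: "\<not> p dvd m"
  shows "(\<Sum>d | d dvd p ^ k * m. f d) = (\<Sum>i\<le>k. \<Sum>d | d dvd m. f (p ^ i * d))"
proof -
  have m0: "m > 0" using m by (intro Nat.gr0I) auto
  have pnd: "\<not> p dvd d" if "d dvd m" for d using m that dvd_trans by blast
  have inj: "inj_on (\<lambda>(i, d). p ^ i * d) ({..k} \<times> {d. d dvd m})"
  proof (rule inj_onI, clarsimp)
    fix i d j d' assume *: "d dvd m" "d' dvd m" "p ^ i * d = p ^ j * d'"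
    have "multiplicity p (p ^ i * d) = i" "multiplicity p (p ^ j * d') = j"
      using p pnd *(1,2) by (auto intro!: multiplicity_eqI simp: mult.commute)
    hence "i = j" using *(3) by simp
    thus "i = j \<and> d = d'" using *(3) p by auto
  qed
  have "{d. d dvd p ^ k * m} = (\<lambda>(i, d). p ^ i * d) ` ({..k} \<times> {d. d dvd m})"
  proof (intro equalityI subsetI)
    fix d assume "d \<in> {d. d dvd p ^ k * m}"
    then obtain a b where "d = a * b" "a dvd p ^ k" "b dvd m" using division_decomp by blast
    thus "d \<in> (\<lambda>(i, d). p ^ i * d) ` ({..k} \<times> {d. d dvd m})"
      using divides_primepow_nat[OF p] by (auto simp: image_iff)
  qed (auto intro!: mult_dvd_mono le_imp_power_dvd)
  hence "(\<Sum>d | d dvd p ^ k * m. f d) = (\<Sum>(i,d)\<in>{..k} \<times> {d. d dvd m}. f (p ^ i * d))"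
    using inj by (simp add: sum.reindex o_def case_prod_unfold)
  also have "\<dots> = (\<Sum>i\<le>k. \<Sum>d | d dvd m. f (p ^ i * d))"
    by (rule sum.cartesian_product[symmetric])
  finally show ?thesis .
qed

section \<open>Real characters, their L-series at 1 and their divisor sums\<close>

text \<open>\<open>chi\<close> is not asked to vanish off the units modulo \<open>M\<close>, so a
  single modulus serves the products over all subsets of a family of symbols. In return the argument
  with value -1 must be prime to \<open>M\<close>, so that multiplication by it permutes the
  residues.\<close>

locale real_nonprincipal_character =
  fixes chi :: "nat \<Rightarrow> real" and M :: nat
  assumes one: "chi 1 = 1" and mult: "chi (m * n) = chi m * chi n"
    and range: "chi n \<in> {-1, 0, 1}" and periodic: "chi (n + M) = chi n"
    and nonprincipal: "\<exists>a. coprime a M \<and> chi a = -1"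
    and modulus_pos: "M > 0"
begin

lemma abs_le_1: "\<bar>chi n\<bar> \<le> 1"
  using range[of n] by auto

lemma periodic_mult: "chi (n + k * M) = chi n"
proof (induction k)
  case (Suc k)
  have "n + Suc k * M = (n + k * M) + M" by simp
  thus ?case using Suc periodic by metis
qed simp

lemma mod_modulus: "chi (n mod M) = chi n"
  using periodic_mult[of "n mod M" "n div M"] by (simp add: mod_mult_div_eq)

lemma sum_period: "(\<Sum>n<M. chi n) = 0"
proof -
  obtain a where a: "coprime a M" "chi a = -1" using nonprincipal by blast
  have inj: "inj_on (\<lambda>n. a * n mod M) {..<M}"
  proof (rule inj_onI)
    fix x y assume "x \<in> {..<M}" "y \<in> {..<M}" "a * x mod M = a * y mod M"
    hence "[x = y] (mod M)" "x < M" "y < M"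
      using a(1) cong_mult_lcancel_nat[of a M x y] by (auto simp: cong_def)
    thus "x = y" by (simp add: cong_def)
  qed
  moreover have "(\<lambda>n. a * n mod M) ` {..<M} = {..<M}"
    using inj modulus_pos by (intro endo_inj_surj) auto
  ultimately have "(\<Sum>n<M. chi n) = (\<Sum>n<M. chi (a * n mod M))"
    using sum.reindex[of "\<lambda>n. a * n mod M" "{..<M}" chi] by simp
  also have "\<dots> = - (\<Sum>n<M. chi n)"
    by (simp add: mod_modulus mult a(2) sum_negf)
  finally show ?thesis by simp
qed

lemma abs_sum_lessThan_le: "\<bar>\<Sum>n<N. chi n\<bar> \<le> M"
proof (induction N rule: less_induct)
  case (less N)
  show ?case
  proof (cases "N < M")
    case True
    have "\<bar>\<Sum>n<N. chi n\<bar> \<le> (\<Sum>n<N. \<bar>chi n\<bar>)" by (rule sum_abs)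
    also have "\<dots> \<le> (\<Sum>n<N. 1)" by (intro sum_mono abs_le_1)
    finally show ?thesis using True by simp
  next
    case False
    define k where "k = N - M"
    have N: "N = M + k" using False by (simp add: k_def)
    have "(\<Sum>n<M + k. chi n) = (\<Sum>n<M. chi n) + (\<Sum>n<k. chi (n + M))"
      by (induction k) (simp_all add: add.commute)
    hence "(\<Sum>n<N. chi n) = (\<Sum>n<k. chi n)" by (simp add: N sum_period periodic)
    thus ?thesis using less[of k] modulus_pos N by simp
  qed
qed

lemma abs_sum_interval_le: "\<bar>\<Sum>n=a..<b. chi n\<bar> \<le> 2 * M"
proof (cases "a \<le> b")
  case True
  have "(\<Sum>n<b. chi n) = (\<Sum>n<a. chi n) + (\<Sum>n=a..<b. chi n)"
    using sum.atLeastLessThan_concat[of 0 a b chi] True by (simp add: lessThan_atLeast0)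
  thus ?thesis using abs_sum_lessThan_le[of a] abs_sum_lessThan_le[of b] by linarith
qed simp

definition L_partial :: "nat \<Rightarrow> real" where "L_partial x = (\<Sum>n=1..x. chi n / n)"

definition L_value :: real where "L_value = lim L_partial"

lemma abs_L_partial_diff_le:
  assumes "a \<le> b"
  shows "\<bar>L_partial b - L_partial a\<bar> \<le> 2 * M / (real a + 1)"
proof -
  have "(\<Sum>n=1..<Suc b. chi n / n) = (\<Sum>n=1..<Suc a. chi n / n) + (\<Sum>n=Suc a..<Suc b. chi n / n)"
    using assms by (subst sum.atLeastLessThan_concat) auto
  hence eq: "L_partial b - L_partial a = (\<Sum>n=Suc a..<Suc b. chi n * (1 / real n))"
    by (simp add: L_partial_def atLeastLessThanSuc_atLeastAtMost)
  have "\<bar>\<Sum>n=Suc a..<Suc b. chi n * (1 / real n)\<bar> \<le> (2 * M) * (1 / real (Suc a))"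
    using abs_sum_interval_le by (intro abel_sum_bound) (auto simp: frac_le)
  thus ?thesis by (simp add: eq add.commute)
qed

lemma L_partial_tendsto: "L_partial \<longlonglongrightarrow> L_value"
proof -
  have "Cauchy L_partial"
  proof (rule metric_CauchyI)
    fix e :: real assume e: "e > 0"
    obtain K :: nat where K: "2 * M / e < real K" using reals_Archimedean2 by blast
    have *: "\<bar>L_partial n - L_partial m\<bar> < e" if "m \<ge> K" "m \<le> n" for m n
    proof -
      have "2 * M < e * real K" using K e by (simp add: field_simps)
      also have "\<dots> \<le> e * (real m + 1)" using that e by simp
      finally have "2 * M / (real m + 1) < e" by (simp add: field_simps)
      thus ?thesis using abs_L_partial_diff_le[OF that(2)] by linarith
    qed
    have "dist (L_partial m) (L_partial n) < e" if "m \<ge> K" "n \<ge> K" for m n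
      using *[of m n] *[of n m] that by (cases "m \<le> n") (auto simp: dist_real_def)
    thus "\<exists>K. \<forall>m\<ge>K. \<forall>n\<ge>K. dist (L_partial m) (L_partial n) < e" by blast
  qed
  hence "convergent L_partial" by (rule Cauchy_convergent)
  thus ?thesis unfolding L_value_def by (simp add: convergent_LIMSEQ_iff)
qed

lemma abs_L_value_diff_le: "\<bar>L_value - L_partial a\<bar> \<le> 2 * M / (real a + 1)"
proof (rule tendsto_upperbound)
  show "(\<lambda>b. \<bar>L_partial b - L_partial a\<bar>) \<longlonglongrightarrow> \<bar>L_value - L_partial a\<bar>"
    by (intro tendsto_intros L_partial_tendsto)
  show "\<forall>\<^sub>F b in sequentially. \<bar>L_partial b - L_partial a\<bar> \<le> 2 * M / (real a + 1)"
    using eventually_ge_at_top[of a] by eventually_elim (rule abs_L_partial_diff_le)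
qed simp

text \<open>The coefficients of zeta(s) L(s, chi). That they are nonnegative, and at least 1 on
  squares, is what makes L(1, chi) = 0 impossible.\<close>

definition divisor_sum :: "nat \<Rightarrow> real" where "divisor_sum n = (\<Sum>d | d dvd n. chi d)"

lemma power: "chi (p ^ k) = chi p ^ k"
  using one by (induction k) (simp_all add: mult)

lemma divisor_sum_prime_power_mult:
  assumes "prime p" "\<not> p dvd m"
  shows "divisor_sum (p ^ k * m) = (\<Sum>i\<le>k. chi p ^ i) * divisor_sum m"
  unfolding divisor_sum_def sum_divisors_prime_power_mult[OF assms]
  by (simp add: mult power sum_product)

text \<open>The sum is k + 1, 1, or an alternating sum ending in 1 or 0, according as
  \<open>chi p\<close> is 1, 0 or -1.\<close>

lemma geometric_sum_nonneg:
  shows "0 \<le> (\<Sum>i\<le>k. chi p ^ i)" and "even k \<Longrightarrow> 1 \<le> (\<Sum>i\<le>k. chi p ^ i)"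
proof -
  have *: "(\<Sum>i\<le>k. chi p ^ i) = (if chi p = 1 then real k + 1 else if chi p = 0 then 1
      else if even k then 1 else 0)" for k
    using range[of p] by (induction k) auto
  show "0 \<le> (\<Sum>i\<le>k. chi p ^ i)" "even k \<Longrightarrow> 1 \<le> (\<Sum>i\<le>k. chi p ^ i)" by (auto simp: *)
qed

lemma divisor_sum_nonneg: "n > 0 \<Longrightarrow> 0 \<le> divisor_sum n"
proof (induction n rule: less_induct)
  case (less n)
  show ?case
  proof (cases "n = 1")
    case True thus ?thesis using one by (simp add: divisor_sum_def)
  next
    case False
    then obtain p where p: "prime p" "p dvd n" using prime_factor_nat by blast
    obtain m where m: "n = p ^ multiplicity p n * m" "\<not> p dvd m"
      using multiplicity_decompose'[of n p] prime_gt_1_nat[OF p(1)] less.prems by auto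
    have "multiplicity p n > 0" using p less.prems by (simp add: prime_multiplicity_gt_zero_iff)
    hence "1 < p ^ multiplicity p n" using p prime_gt_1_nat one_less_power by blast
    moreover have "m > 0" using m(2) by (intro Nat.gr0I) auto
    ultimately have "m < n" by (subst m(1)) simp
    thus ?thesis
      using less.IH[of m] \<open>m > 0\<close> geometric_sum_nonneg(1)
      by (subst m(1)) (simp add: divisor_sum_prime_power_mult[OF p(1) m(2)])
  qed
qed

lemma divisor_sum_square: "n > 0 \<Longrightarrow> 1 \<le> divisor_sum (n\<^sup>2)"
proof (induction n rule: less_induct)
  case (less n)
  show ?case
  proof (cases "n = 1")
    case True thus ?thesis using one by (simp add: divisor_sum_def)
  next
    case False
    then obtain p where p: "prime p" "p dvd n" using prime_factor_nat by blast
    obtain m where m: "n = p ^ multiplicity p n * m" "\<not> p dvd m"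
      using multiplicity_decompose'[of n p] prime_gt_1_nat[OF p(1)] less.prems by auto
    have "multiplicity p n > 0" using p less.prems by (simp add: prime_multiplicity_gt_zero_iff)
    hence "1 < p ^ multiplicity p n" using p prime_gt_1_nat one_less_power by blast
    moreover have m0: "m > 0" using m(2) by (intro Nat.gr0I) auto
    ultimately have "m < n" by (subst m(1)) simp
    have "n\<^sup>2 = p ^ (2 * multiplicity p n) * m\<^sup>2"
      by (subst m(1)) (simp add: power_mult_distrib power_mult[symmetric] mult.commute)
    moreover have "\<not> p dvd m\<^sup>2" using p m(2) prime_dvd_power by blast
    ultimately have "divisor_sum (n\<^sup>2) = (\<Sum>i\<le>2 * multiplicity p n. chi p ^ i) * divisor_sum (m\<^sup>2)"
      using divisor_sum_prime_power_mult p(1) by metis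
    moreover have "1 * 1 \<le> (\<Sum>i\<le>2 * multiplicity p n. chi p ^ i) * divisor_sum (m\<^sup>2)"
      using less.IH[OF \<open>m < n\<close> m0] geometric_sum_nonneg(2)[of "2 * multiplicity p n" p]
      by (intro mult_mono) auto
    ultimately show ?thesis by simp
  qed
qed

end

section \<open>Nonvanishing of L(1, chi)\<close>

text \<open>AM-GM on the terms i and n - 1 - i. Writing the ratio as a square keeps their geometric
  mean an integral power of s.\<close>

lemma geometric_sum_ge:
  fixes s :: real assumes "0 < s"
  shows "real n * s ^ (n - 1) \<le> (\<Sum>i<n. (s\<^sup>2) ^ i)"
proof -
  have "2 * (\<Sum>i<n. (s\<^sup>2) ^ i) = (\<Sum>i<n. (s\<^sup>2) ^ i + (s\<^sup>2) ^ (n - Suc i))"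
    using sum.nat_diff_reindex[of "\<lambda>i. (s\<^sup>2) ^ i" n] by (simp add: sum.distrib)
  also have "\<dots> \<ge> (\<Sum>i<n. 2 * s ^ (n - 1))"
  proof (rule sum_mono)
    fix i assume "i \<in> {..<n}"
    hence "s ^ (n - 1) = s ^ i * s ^ (n - Suc i)" by (simp add: power_add[symmetric])
    moreover have "0 \<le> (s ^ i - s ^ (n - Suc i))\<^sup>2" by simp
    hence "2 * (s ^ i * s ^ (n - Suc i)) \<le> (s ^ i)\<^sup>2 + (s ^ (n - Suc i))\<^sup>2"
      by (simp add: power2_diff algebra_simps)
    ultimately show "2 * s ^ (n - 1) \<le> (s\<^sup>2) ^ i + (s\<^sup>2) ^ (n - Suc i)"
      by (simp add: power_mult[symmetric] mult.commute)
  qed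
  finally show ?thesis by simp
qed

text \<open>The coefficients of Monsky's Lambert series argument for \<open>L(1, chi) \<noteq> 0\<close>.\<close>
definition monsky :: "real \<Rightarrow> nat \<Rightarrow> real" where
  "monsky t n = 1 / (real n * (1 - t)) - t ^ n / (1 - t ^ n)"

lemma monsky_eq:
  assumes "0 < t" "t < 1" "n > 0"
  shows "(1 - t) * monsky t n = 1 / real n - t ^ n / (\<Sum>i<n. t ^ i)"
proof -
  have "(\<Sum>i<n. t ^ i) = (1 - t ^ n) / (1 - t)"
    using assms by (simp add: sum_gp_strict)
  moreover have "(1 - t) * (1 / (real n * (1 - t))) = 1 / real n" using assms by simp
  moreover have "(1 - t) * (t ^ n / (1 - t ^ n)) = t ^ n / ((1 - t ^ n) / (1 - t))" by simp
  ultimately show ?thesis unfolding monsky_def right_diff_distrib by simp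
qed

text \<open>With G n = 1 + t + ... + t^(n-1), the difference of consecutive terms times 1 - t is
  1/(n (n+1)) - t^n / (G n * G (n+1)). The AM-GM bounds G n \<ge> n s^n and G (n+1) \<ge> (n+1) s^n
  multiply to n (n+1) t^n, which makes it nonnegative.\<close>

lemma monsky_nonneg_decreasing:
  assumes s: "0 < s" "s < 1" and n: "n > 0"
  shows "0 \<le> monsky (s\<^sup>2) n" and "monsky (s\<^sup>2) (Suc n) \<le> monsky (s\<^sup>2) n"
proof -
  define t where "t = s\<^sup>2"
  have t: "0 < t" "t < 1" using s by (simp_all add: t_def power_less_one_iff)
  define G where "G n = (\<Sum>i<n. t ^ i)" for n
  have G: "real n * s ^ n \<le> G n" "0 < G n" if "n > 0" for n
  proof -
    have "s ^ n \<le> s ^ (n - 1)" using s by (intro power_decreasing) auto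
    hence "real n * s ^ n \<le> real n * s ^ (n - 1)" by (intro mult_left_mono) auto
    thus "real n * s ^ n \<le> G n" unfolding G_def t_def using geometric_sum_ge[OF s(1), of n] by linarith
    moreover have "0 < real n * s ^ n" using s that by simp
    ultimately show "0 < G n" by linarith
  qed
  have GS: "G (Suc n) = G n + t ^ n" for n by (simp add: G_def)
  have tn: "t ^ n = s ^ n * s ^ n" for n by (simp add: t_def power2_eq_square power_mult_distrib)
  have mg: "(1 - t) * monsky t n = 1 / real n - t ^ n / G n" if "n > 0" for n
    using monsky_eq[OF t that] by (simp add: G_def)
  have "real n * t ^ n \<le> real n * s ^ n"
    using s unfolding tn by (intro mult_left_mono) (auto simp: mult_le_one power_le_one mult_left_le)
  hence "real n * t ^ n \<le> G n" using G(1)[OF n] by linarith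
  hence "t ^ n / G n \<le> 1 / real n" using G(2)[OF n] n by (simp add: field_simps)
  hence "0 \<le> (1 - t) * monsky t n" using mg[OF n] by simp
  thus "0 \<le> monsky (s\<^sup>2) n" using t by (simp add: t_def[symmetric] zero_le_mult_iff)
  have "(1 - t) * (monsky t n - monsky t (Suc n))
      = 1 / (real n * real (Suc n)) - t ^ n / (G n * G (Suc n))"
  proof -
    have "(1 - t) * (monsky t n - monsky t (Suc n))
        = (1 / real n - 1 / real (Suc n)) - (t ^ n / G n - t ^ Suc n / G (Suc n))"
      using mg[OF n] mg[of "Suc n"] by (simp add: right_diff_distrib)
    also have "1 / real n - 1 / real (Suc n) = 1 / (real n * real (Suc n))"
      using n by (simp add: field_simps)
    also have "t ^ n / G n - t ^ Suc n / G (Suc n) = t ^ n * (G (Suc n) - t * G n) / (G n * G (Suc n))"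
      using G(2)[OF n] G(2)[of "Suc n"] by (simp add: field_simps)
    also have "G (Suc n) - t * G n = 1"
    proof -
      have "G (Suc n) = 1 + t * G n" unfolding G_def
        by (simp add: sum.lessThan_Suc_shift sum_distrib_left del: sum.lessThan_Suc)
      thus ?thesis by simp
    qed
    finally show ?thesis by simp
  qed
  also have "\<dots> \<ge> 0"
  proof -
    have "real (Suc n) * s ^ n \<le> G (Suc n)"
      using geometric_sum_ge[OF s(1), of "Suc n"] by (simp add: G_def t_def)
    hence "(real n * s ^ n) * (real (Suc n) * s ^ n) \<le> G n * G (Suc n)"
      using G[OF n] G(2)[of "Suc n"] s by (intro mult_mono) auto
    hence "t ^ n * (real n * real (Suc n)) \<le> G n * G (Suc n)" by (simp add: tn mult_ac)
    hence "t ^ n / (G n * G (Suc n)) \<le> 1 / (real n * real (Suc n))"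
      using G(2)[OF n] G(2)[of "Suc n"] n by (simp add: field_simps del: of_nat_Suc)
    thus ?thesis by simp
  qed
  finally show "monsky (s\<^sup>2) (Suc n) \<le> monsky (s\<^sup>2) n"
    using t by (simp add: t_def[symmetric] zero_le_mult_iff)
qed

context real_nonprincipal_character
begin

text \<open>A finite form of the identity between the power series of \<open>divisor_sum\<close> and
  the Lambert series of \<open>chi\<close>. On the left only the squares up to K^2 are kept; on the
  right each inner geometric sum is completed to infinity, and the N tails cost at most t^N / (1 -
  t) each.\<close>

lemma lambert_sum_le:
  assumes t: "0 < t" "t < 1" and N: "K\<^sup>2 \<le> N"
  shows "real K * t ^ (K\<^sup>2) \<le> (\<Sum>n=1..N. chi n * (t ^ n / (1 - t ^ n))) + real N * t ^ N / (1 - t)"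
proof -
  have "real K * t ^ (K\<^sup>2) = (\<Sum>j=1..K. t ^ (K\<^sup>2))" by simp
  also have "\<dots> \<le> (\<Sum>j=1..K. divisor_sum (j\<^sup>2) * t ^ (j\<^sup>2))"
  proof (rule sum_mono)
    fix j assume j: "j \<in> {1..K}"
    have "1 * t ^ (K\<^sup>2) \<le> divisor_sum (j\<^sup>2) * t ^ (j\<^sup>2)"
      using j t divisor_sum_square[of j] by (intro mult_mono power_decreasing) auto
    thus "t ^ (K\<^sup>2) \<le> divisor_sum (j\<^sup>2) * t ^ (j\<^sup>2)" by simp
  qed
  also have "\<dots> = (\<Sum>n\<in>(\<lambda>j. j\<^sup>2) ` {1..K}. divisor_sum n * t ^ n)"
    by (subst sum.reindex) (auto simp: inj_on_def)
  also have "\<dots> \<le> (\<Sum>n=1..N. divisor_sum n * t ^ n)"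
  proof (rule sum_mono2)
    show "(\<lambda>j. j\<^sup>2) ` {1..K} \<subseteq> {1..N}"
    proof
      fix n assume "n \<in> (\<lambda>j. j\<^sup>2) ` {1..K}"
      then obtain j where "n = j\<^sup>2" "1 \<le> j" "j \<le> K" by auto
      moreover have "j\<^sup>2 \<le> N" using N power_mono[of j K 2] \<open>j \<le> K\<close> by linarith
      ultimately show "n \<in> {1..N}" by simp
    qed
    fix n assume "n \<in> {1..N} - (\<lambda>j. j\<^sup>2) ` {1..K}"
    thus "0 \<le> divisor_sum n * t ^ n" using t divisor_sum_nonneg[of n] by auto
  qed simp
  also have "\<dots> = (\<Sum>n=1..N. \<Sum>d | d dvd n. chi d * t ^ (d * (n div d)))"
    by (intro sum.cong refl) (auto simp: divisor_sum_def sum_distrib_right)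
  also have "\<dots> = (\<Sum>d=1..N. \<Sum>m=1..N div d. chi d * t ^ (d * m))"
    by (rule sum_divisors_hyperbola)
  also have "\<dots> \<le> (\<Sum>d=1..N. chi d * (t ^ d / (1 - t ^ d)) + t ^ N / (1 - t))"
  proof (rule sum_mono)
    fix d assume d: "d \<in> {1..N}"
    define y where "y = N div d"
    have td: "t ^ d < 1" "t ^ d \<le> t" "0 < t ^ d"
      using d t power_decreasing[of 1 d t] by (auto simp: power_less_one_iff)
    have "(\<Sum>m=1..y. chi d * t ^ (d * m)) = chi d * (\<Sum>m=1..y. (t ^ d) ^ m)"
      by (simp add: sum_distrib_left power_mult)
    also have "(\<Sum>m=1..y. (t ^ d) ^ m) = t ^ d / (1 - t ^ d) - (t ^ d) ^ Suc y / (1 - t ^ d)"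
      using td by (subst sum_gp) (auto simp: diff_divide_distrib)
    finally have "(\<Sum>m=1..y. chi d * t ^ (d * m)) =
        chi d * (t ^ d / (1 - t ^ d)) - chi d * ((t ^ d) ^ Suc y / (1 - t ^ d))"
      by (simp add: right_diff_distrib)
    moreover have "\<bar>chi d * ((t ^ d) ^ Suc y / (1 - t ^ d))\<bar> \<le> 1 * (t ^ N / (1 - t))"
      unfolding abs_mult
    proof (rule mult_mono)
      \<comment> \<open>The first omitted exponent \<open>d * Suc y\<close> already exceeds
        N.\<close>
      have "N < d * Suc y" unfolding y_def using d
        by (metis atLeastAtMost_iff dividend_less_times_div less_eq_Suc_le mult_Suc_right One_nat_def)
      hence "(t ^ d) ^ Suc y \<le> t ^ N" unfolding power_mult[symmetric]
        using t by (intro power_decreasing) auto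
      thus "\<bar>(t ^ d) ^ Suc y / (1 - t ^ d)\<bar> \<le> t ^ N / (1 - t)"
        using td t by (simp add: abs_mult frac_le)
    qed (use abs_le_1 in auto)
    ultimately show "(\<Sum>m=1..N div d. chi d * t ^ (d * m))
        \<le> chi d * (t ^ d / (1 - t ^ d)) + t ^ N / (1 - t)"
      unfolding y_def by linarith
  qed
  finally show ?thesis by (simp add: sum.distrib)
qed

text \<open>If L(1, chi) = 0, the Lambert series equals minus the sum of
  \<open>chi n * monsky t n\<close>, which summation by parts bounds by 2M uniformly in t because
  \<open>monsky t 1\<close> is 1. But it is at least K t^(K^2), which tends to K as t approaches
  1.\<close>

lemma L_value_nonzero: "L_value \<noteq> 0"
proof
  assume L0: "L_value = 0"
  have bound: "real K * (s\<^sup>2) ^ (K\<^sup>2) \<le> 2 * M" if s: "0 < s" "s < 1" for s K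
  proof -
    define t where "t = s\<^sup>2"
    have t: "0 < t" "t < 1" using s by (simp_all add: t_def power_less_one_iff)
    have "real K * t ^ (K\<^sup>2) \<le> L_partial N / (1 - t) + 2 * M + real N * t ^ N / (1 - t)"
      if N: "K\<^sup>2 \<le> N" for N
    proof -
      have "\<bar>\<Sum>n=1..<Suc N. chi n * monsky t n\<bar> \<le> (2 * M) * monsky t 1"
        using monsky_nonneg_decreasing[OF s] abs_sum_interval_le
        by (intro abel_sum_bound) (auto simp: t_def)
      moreover have "monsky t 1 = 1" using t by (simp add: monsky_def diff_divide_distrib[symmetric])
      ultimately have *: "\<bar>\<Sum>n=1..N. chi n * monsky t n\<bar> \<le> 2 * M"
        by (simp add: atLeastLessThanSuc_atLeastAtMost)
      have "(\<Sum>n=1..N. chi n * (t ^ n / (1 - t ^ n))) =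
          (\<Sum>n=1..N. chi n / n / (1 - t) - chi n * monsky t n)"
        by (intro sum.cong refl) (simp add: monsky_def right_diff_distrib)
      also have "\<dots> = L_partial N / (1 - t) - (\<Sum>n=1..N. chi n * monsky t n)"
        by (simp add: sum_subtractf L_partial_def sum_divide_distrib)
      finally show ?thesis using lambert_sum_le[OF t N] * by linarith
    qed
    moreover have "(\<lambda>N. L_partial N / (1 - t) + 2 * M + real N * t ^ N / (1 - t))
        \<longlonglongrightarrow> 0 / (1 - t) + 2 * M + 0 / (1 - t)"
      using L_partial_tendsto L0 t by (intro tendsto_intros powser_times_n_limit_0) auto
    ultimately have "real K * t ^ (K\<^sup>2) \<le> 0 / (1 - t) + 2 * M + 0 / (1 - t)"
      by (intro LIMSEQ_le_const) blast+
    thus ?thesis by (simp add: t_def)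
  qed
  \<comment> \<open>Any K above the uniform bound 2M contradicts it in the limit.\<close>
  define K where "K = 2 * M + 1"
  have "((\<lambda>s::real. real K * (s\<^sup>2) ^ (K\<^sup>2)) \<longlongrightarrow> real K * (1\<^sup>2) ^ (K\<^sup>2)) (at_left 1)"
    by (intro tendsto_intros)
  moreover have "\<forall>\<^sub>F s in at_left (1::real). real K * (s\<^sup>2) ^ (K\<^sup>2) \<le> 2 * M"
    using eventually_at_left_real[OF zero_less_one]
  proof eventually_elim
    case (elim s)
    thus ?case using bound[of s K] by simp
  qed
  ultimately have "real K * (1\<^sup>2) ^ (K\<^sup>2) \<le> 2 * M"
    by (rule tendsto_upperbound) simp
  thus False by (simp add: K_def)
qed

section \<open>Sums of chi(n) Lambda(n) / n, and primes with given character values\<close>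

lemma sum_chi_ln_bounded: "\<exists>C. \<forall>x\<ge>2. \<bar>\<Sum>n=1..x. chi n * ln n / n\<bar> \<le> C"
proof -
  \<comment> \<open>ln x / x decreases only beyond e, so the terms with n < 3 are split off
    below.\<close>
  have decr: "ln (real (Suc n)) / real (Suc n) \<le> ln (real n) / real n" if n: "n \<ge> 3" for n
  proof -
    have "real (Suc n) / real n = 1 + 1 / real n" using n by (simp add: field_simps)
    hence "ln (real (Suc n)) = ln (real n) + ln (1 + 1 / real n)"
      using n ln_div[of "real (Suc n)" "real n"] by simp
    also have "\<dots> \<le> ln (real n) + 1 / real n" using ln_add_one_self_le_self[of "1 / real n"] by simp
    finally have "ln (real (Suc n)) * real n \<le> ln (real n) * real n + 1" using n by (simp add: field_simps)
    also have "1 \<le> ln (real n)"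
      using exp_le n by (subst ln_ge_iff) auto
    finally show ?thesis using n by (simp add: field_simps)
  qed
  have "\<bar>\<Sum>n=1..x. chi n * ln n / n\<bar> \<le> \<bar>\<Sum>n=1..<3. chi n * ln n / n\<bar> + 2 * M * (ln (real 3) / real 3)"
    if "x \<ge> 2" for x
  proof -
    have "(\<Sum>n=1..x. chi n * ln n / n) = (\<Sum>n=1..<3. chi n * ln n / n) + (\<Sum>n=3..<Suc x. chi n * ln n / n)"
      using that by (subst sum.atLeastLessThan_concat) (auto simp: atLeastLessThanSuc_atLeastAtMost)
    moreover have "\<bar>\<Sum>n=3..<Suc x. chi n * (ln n / n)\<bar> \<le> 2 * M * (ln (real 3) / real 3)"
      by (rule abel_sum_bound[OF abs_sum_interval_le]) (use decr in auto)
    ultimately show ?thesis by simp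
  qed
  thus ?thesis by blast
qed

text \<open>\<open>chi\<close> times \<open>ln\<close> is the Dirichlet convolution of
  \<open>chi\<close> times \<open>mangoldt\<close> with \<open>chi\<close>. Replacing
  \<open>L_partial (x div d)\<close> by \<open>L_value\<close> costs at most 2M d / x per unit of
  \<open>mangoldt d / d\<close>, in total 8M by Chebyshev's bound; then one divides by
  \<open>L_value\<close>.\<close>

lemma sum_chi_mangoldt_bounded: "\<exists>C. \<forall>x\<ge>2. \<bar>\<Sum>n=1..x. chi n * mangoldt n / n\<bar> \<le> C"
proof -
  obtain C where C: "\<And>x. x \<ge> 2 \<Longrightarrow> \<bar>\<Sum>n=1..x. chi n * ln n / n\<bar> \<le> C"
    using sum_chi_ln_bounded by blast
  have "\<bar>\<Sum>n=1..x. chi n * mangoldt n / n\<bar> \<le> (C + 8 * M) / \<bar>L_value\<bar>" if x: "x \<ge> 2" for x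
  proof -
    have "(\<Sum>n=1..x. chi n * ln n / n) =
        (\<Sum>n=1..x. \<Sum>d | d dvd n. chi d * mangoldt d / d * (chi (n div d) / (n div d)))"
    proof (rule sum.cong, simp)
      fix n assume n: "n \<in> {1..x}"
      have "chi n * ln n / n = (\<Sum>d | d dvd n. chi n * mangoldt d / n)"
        using n mangoldt_sum[of n, where 'a = real]
        by (simp add: sum_distrib_left[symmetric] sum_divide_distrib[symmetric])
      also have "\<dots> = (\<Sum>d | d dvd n. chi d * mangoldt d / d * (chi (n div d) / (n div d)))"
        using n by (intro sum.cong refl) (auto simp: mult field_simps)
      finally show "chi n * ln n / n = \<dots>" .
    qed
    also have "\<dots> = (\<Sum>d=1..x. \<Sum>m=1..x div d. chi d * mangoldt d / d * (chi m / m))"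
      by (rule sum_divisors_hyperbola)
    also have "\<dots> = (\<Sum>d=1..x. chi d * mangoldt d / d * L_partial (x div d))"
      by (simp add: L_partial_def sum_distrib_left)
    finally have eq: "L_value * (\<Sum>n=1..x. chi n * mangoldt n / n) = (\<Sum>n=1..x. chi n * ln n / n)
        + (\<Sum>d=1..x. chi d * mangoldt d / d * (L_value - L_partial (x div d)))"
      by (simp add: sum_distrib_left right_diff_distrib sum_subtractf diff_divide_distrib mult_ac)
    have "\<bar>\<Sum>d=1..x. chi d * mangoldt d / d * (L_value - L_partial (x div d))\<bar> \<le>
        (\<Sum>d=1..x. \<bar>chi d * mangoldt d / d * (L_value - L_partial (x div d))\<bar>)"
      by (rule sum_abs)
    also have "\<dots> \<le> (\<Sum>d=1..x. 2 * M / x * mangoldt d)"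
    proof (rule sum_mono)
      fix d assume d: "d \<in> {1..x}"
      have "x \<le> d * (x div d + 1)"
        using dividend_less_times_div[of d x] d by auto
      hence le: "real x \<le> real d * (real (x div d) + 1)"
        by (metis of_nat_1 of_nat_add of_nat_le_iff of_nat_mult)
      have "\<bar>chi d * mangoldt d / d * (L_value - L_partial (x div d))\<bar>
          = \<bar>chi d\<bar> * (mangoldt d / d * \<bar>L_value - L_partial (x div d)\<bar>)"
        by (simp add: abs_mult)
      also have "\<dots> \<le> 1 * (mangoldt d / d * (2 * M / (real (x div d) + 1)))"
        using abs_le_1 abs_L_value_diff_le mangoldt_nonneg by (intro mult_mono) auto
      also have "\<dots> = 2 * M * mangoldt d / (real d * (real (x div d) + 1))"
        by simp
      also have "\<dots> \<le> 2 * M * mangoldt d / x"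
        using le x mangoldt_nonneg[of d] by (intro divide_left_mono) (auto intro!: mult_pos_pos add_nonneg_pos)
      finally show "\<bar>chi d * mangoldt d / d * (L_value - L_partial (x div d))\<bar> \<le> 2 * M / x * mangoldt d"
        by simp
    qed
    also have "\<dots> = 2 * M / x * (\<Sum>d=1..x. mangoldt d)" by (simp add: sum_distrib_left)
    also have "\<dots> \<le> 2 * M / x * (4 * real x)"
      by (intro mult_left_mono chebyshev_psi_le) simp
    also have "\<dots> = 8 * M" using x by simp
    finally have "\<bar>L_value * (\<Sum>n=1..x. chi n * mangoldt n / n)\<bar> \<le> C + 8 * M"
      using C[OF x] unfolding eq by linarith
    thus ?thesis using L_value_nonzero by (simp add: abs_mult field_simps)
  qed
  thus ?thesis by blast
qed

end

text \<open>Used for the primes dividing the modulus. Every power of p has weight ln p, and the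
  geometric series in 1/p is dominated by the one in 1/2, whose partial sums stay below 1.\<close>

lemma sum_mangoldt_prime_powers_le:
  assumes "finite P" "\<And>p. p \<in> P \<Longrightarrow> prime p"
  shows "(\<Sum>n\<in>(\<lambda>(p, k). p ^ k) ` (P \<times> {1..x}). mangoldt n / n) \<le> (\<Sum>p\<in>P. ln (real p))"
proof -
  have half: "(\<Sum>k=1..x. (1 / 2 :: real) ^ k) = 1 - (1 / 2) ^ x" by (induction x) auto
  have "(\<Sum>n\<in>(\<lambda>(p, k). p ^ k) ` (P \<times> {1..x}). mangoldt n / real n) \<le>
      (\<Sum>(p, k)\<in>P \<times> {1..x}. mangoldt (p ^ k) / real (p ^ k))"
    using sum_image_le[of "P \<times> {1..x}" "\<lambda>n. mangoldt n / real n" "\<lambda>(p, k). p ^ k"] assms(1)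
    by (simp add: mangoldt_nonneg o_def case_prod_unfold)
  also have "\<dots> = (\<Sum>p\<in>P. \<Sum>k=1..x. mangoldt (p ^ k) / real (p ^ k))"
    by (rule sum.cartesian_product[symmetric])
  also have "\<dots> \<le> (\<Sum>p\<in>P. ln (real p))"
  proof (rule sum_mono)
    fix p assume "p \<in> P"
    hence p: "prime p" using assms by blast
    hence p2: "2 \<le> real p" using prime_ge_2_nat by fastforce
    have "(\<Sum>k=1..x. mangoldt (p ^ k) / real (p ^ k)) = ln (real p) * (\<Sum>k=1..x. (1 / real p) ^ k)"
      using p by (auto simp: sum_distrib_left power_one_over field_simps intro!: sum.cong)
    also have "(\<Sum>k=1..x. (1 / real p) ^ k) \<le> (\<Sum>k=1..x. (1 / 2) ^ k)"
      using p2 by (intro sum_mono power_mono) (auto simp: field_simps)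
    also have "\<dots> \<le> 1" by (simp only: half) simp
    finally show "(\<Sum>k=1..x. mangoldt (p ^ k) / real (p ^ k)) \<le> ln (real p)"
      using p2 by (simp add: mult_left_mono mult_left_le)
  qed
  finally show ?thesis .
qed

text \<open>Used for the even prime powers: \<open>mangoldt\<close> at m^2 is at most 2 ln m \<le> 4
  sqrt m, so the terms are O(m^(-3/2)).\<close>

lemma sum_mangoldt_squares_bounded: "\<exists>C. \<forall>x. (\<Sum>n\<in>(\<lambda>m. m\<^sup>2) ` {1..x}. mangoldt n / real n) \<le> C"
proof -
  have summable: "summable (\<lambda>m. 4 * real m powr (-3/2))"
    by (intro summable_mult) (simp add: summable_real_powr_iff)
  have "(\<Sum>n\<in>(\<lambda>m. m\<^sup>2) ` {1..x}. mangoldt n / real n) \<le> (\<Sum>m. 4 * real m powr (-3/2))" for x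
  proof -
    have "(\<Sum>n\<in>(\<lambda>m. m\<^sup>2) ` {1..x}. mangoldt n / real n) = (\<Sum>m=1..x. mangoldt (m\<^sup>2) / real (m\<^sup>2))"
      by (subst sum.reindex) (auto simp: inj_on_def)
    also have "\<dots> \<le> (\<Sum>m=1..x. 4 * real m powr (-3/2))"
    proof (rule sum_mono)
      fix m assume m: "m \<in> {1..x}"
      have "mangoldt (m\<^sup>2) \<le> ln (real (m\<^sup>2))" using m by (intro mangoldt_le) auto
      also have "\<dots> = 2 * ln (real m)" using m by (simp add: ln_realpow)
      also have "ln (real m) \<le> real m powr (1/2) / (1/2)" using m by (intro ln_powr_bound) auto
      finally have "mangoldt (m\<^sup>2) / real (m\<^sup>2) \<le> 4 * real m powr (1/2) / (real m)\<^sup>2"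
        using m by (simp add: divide_right_mono)
      also have "\<dots> = 4 * real m powr (-3/2)"
      proof -
        have "real m powr (-3/2) * (real m)\<^sup>2 = real m powr (-3/2) * real m powr 2"
          using m by (simp add: powr_numeral)
        also have "\<dots> = real m powr (1/2)" by (subst powr_add[symmetric]) simp
        finally have eq: "real m powr (1/2) = real m powr (-3/2) * (real m)\<^sup>2" by simp
        show ?thesis unfolding eq using m by simp
      qed
      finally show "mangoldt (m\<^sup>2) / real (m\<^sup>2) \<le> 4 * real m powr (-3/2)" .
    qed
    also have "\<dots> \<le> (\<Sum>m. 4 * real m powr (-3/2))"
      by (rule sum_le_suminf[OF summable]) auto
    finally show ?thesis .
  qed
  thus ?thesis by blast
qed

text \<open>
  Expand the indicator \<open>\<Prod>i\<in>I. 1 + e i \<chi>\<^sub>i\<close> into characters: the trivial one contributes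
  \<open>ln x\<close> to the sum of \<open>\<Lambda>(n)/n\<close>, the others \<open>O(1)\<close>. An odd power of a prime \<open>p\<close> has the same
  character values as \<open>p\<close>, so if no prime qualified, only squares and powers of prime
  factors of the modulus would contribute, again \<open>O(1)\<close>.
\<close>
theorem exists_prime_with_character_values:
  fixes chi :: "'i \<Rightarrow> nat \<Rightarrow> real" and M :: nat and e :: "'i \<Rightarrow> real"
  assumes I: "finite I" and M: "M > 0"
    and char: "\<And>J. J \<subseteq> I \<Longrightarrow> J \<noteq> {} \<Longrightarrow> real_nonprincipal_character (\<lambda>n. \<Prod>i\<in>J. chi i n) M"
    and nonzero: "\<And>i n. i \<in> I \<Longrightarrow> coprime n M \<Longrightarrow> chi i n \<noteq> 0"
    and e: "\<And>i. i \<in> I \<Longrightarrow> e i = 1 \<or> e i = -1"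
  shows "\<exists>q. prime q \<and> \<not> q dvd M \<and> (\<forall>i\<in>I. chi i q = e i)"
proof (rule ccontr)
  assume no: "\<not> ?thesis"
  define w where "w n = (\<Prod>i\<in>I. e i * chi i n + 1)" for n
  have char1: "real_nonprincipal_character (chi i) M" if "i \<in> I" for i
    using char[of "{i}"] that by simp
  have range: "chi i n \<in> {-1, 0, 1}" if "i \<in> I" for i n
    using real_nonprincipal_character.range[OF char1[OF that]] .
  have power: "chi i (n ^ k) = chi i n ^ k" if "i \<in> I" for i n k
    using real_nonprincipal_character.power[OF char1[OF that]] .
  have w_bounds: "0 \<le> w n \<and> w n \<le> 2 ^ card I" for n
  proof -
    have "0 \<le> e i * chi i n + 1 \<and> e i * chi i n + 1 \<le> 2" if "i \<in> I" for i
      using range[OF that, of n] e[OF that] by auto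
    thus ?thesis unfolding w_def using prod_mono[of I "\<lambda>i. e i * chi i n + 1" "\<lambda>_. 2"]
      by (auto intro!: prod_nonneg)
  qed
  define S where "S x = (\<Sum>n=1..x. w n * (mangoldt n / n))" for x

  obtain C1 where C1: "\<And>x. x \<ge> 2 \<Longrightarrow> ln (real x) - C1 \<le> S x"
  proof -
    have "\<forall>J\<in>Pow I - {{}}. \<exists>C. \<forall>x\<ge>2. \<bar>\<Sum>n=1..x. (\<Prod>i\<in>J. chi i n) * mangoldt n / n\<bar> \<le> C"
      using real_nonprincipal_character.sum_chi_mangoldt_bounded[OF char] by blast
    then obtain C where C: "\<And>J x. J \<in> Pow I - {{}} \<Longrightarrow> x \<ge> 2 \<Longrightarrow>
        \<bar>\<Sum>n=1..x. (\<Prod>i\<in>J. chi i n) * mangoldt n / n\<bar> \<le> C J"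
      by metis
    have "ln (real x) - (1 + (\<Sum>J\<in>Pow I - {{}}. C J)) \<le> S x" if x: "x \<ge> 2" for x
    proof -
      define T where "T J = (\<Prod>i\<in>J. e i) * (\<Sum>n=1..x. (\<Prod>i\<in>J. chi i n) * mangoldt n / n)" for J
      have "S x = (\<Sum>n=1..x. \<Sum>J\<in>Pow I. (\<Prod>i\<in>J. e i) * ((\<Prod>i\<in>J. chi i n) * mangoldt n / n))"
        unfolding S_def w_def prod_add[OF I] sum_distrib_right by (simp add: prod.distrib mult_ac)
      also have "\<dots> = (\<Sum>J\<in>Pow I. T J)"
        unfolding T_def sum_distrib_left by (rule sum.swap)
      also have "\<dots> = T {} + (\<Sum>J\<in>Pow I - {{}}. T J)"
        using I by (subst sum.remove[of "Pow I" "{}"]) auto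
      finally have Sx: "S x = T {} + (\<Sum>J\<in>Pow I - {{}}. T J)" .
      have "\<bar>\<Sum>J\<in>Pow I - {{}}. T J\<bar> \<le> (\<Sum>J\<in>Pow I - {{}}. \<bar>T J\<bar>)" by (rule sum_abs)
      also have "\<dots> \<le> (\<Sum>J\<in>Pow I - {{}}. C J)"
      proof (rule sum_mono)
        fix J assume J: "J \<in> Pow I - {{}}"
        have "\<bar>\<Prod>i\<in>J. e i\<bar> = (\<Prod>i\<in>J. \<bar>e i\<bar>)" by (rule abs_prod)
        also have "\<dots> = 1" using J e by (intro prod.neutral) fastforce
        finally show "\<bar>T J\<bar> \<le> C J" using C[OF J x] by (simp add: T_def abs_mult)
      qed
      finally show ?thesis using Sx ln_le_sum_mangoldt[of x] x by (simp add: T_def)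
    qed
    thus ?thesis using that by blast
  qed

  obtain C2 where C2: "\<And>x. S x \<le> C2"
  proof -
    define P where "P = {p. prime p \<and> p dvd M}"
    have P: "finite P" "\<And>p. p \<in> P \<Longrightarrow> prime p" using M by (auto simp: P_def)
    obtain C where C: "\<And>x. (\<Sum>n\<in>(\<lambda>m. m\<^sup>2) ` {1..x}. mangoldt n / real n) \<le> C"
      using sum_mangoldt_squares_bounded by blast
    have "S x \<le> 2 ^ card I * ((\<Sum>p\<in>P. ln (real p)) + C)" for x
    proof -
      define A where "A = (\<lambda>(p, k). p ^ k) ` (P \<times> {1..x})"
      define B where "B = (\<lambda>m::nat. m\<^sup>2) ` {1..x}"
      have fin: "finite A" "finite B" using P by (auto simp: A_def B_def)
      have vanish: "w n * (mangoldt n / n) = 0" if n: "n \<in> {1..x} - (A \<union> B)" for n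
      proof (rule ccontr)
        assume "w n * (mangoldt n / n) \<noteq> 0"
        hence wn: "w n \<noteq> 0" and "primepow n" by (auto simp: mangoldt_def split: if_splits)
        then obtain p k where pk: "prime p" "k > 0" "n = p ^ k" by (auto simp: primepow_def)
        have bound: "j \<le> p ^ j" for j using pk(1) less_exp[of j] power_mono[of 2 p j] prime_ge_2_nat by fastforce
        have "k \<le> x" using bound[of k] n pk by auto
        have "\<not> p dvd M"
        proof
          assume "p dvd M"
          hence "(p, k) \<in> P \<times> {1..x}" using pk \<open>k \<le> x\<close> by (simp add: P_def)
          hence "n \<in> A" unfolding A_def pk(3) by (rule rev_image_eqI) simp
          thus False using n by simp
        qed
        hence "coprime p M" using pk(1) by (simp add: prime_imp_coprime)
        \<comment> \<open>A nonzero factor of \<open>w n\<close> excludes the value -e i, and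
          coprimality to M excludes 0.\<close>
        have val: "chi i p ^ k = e i" if i: "i \<in> I" for i
        proof -
          have "e i * chi i n + 1 \<noteq> 0" using wn i I unfolding w_def by auto
          moreover have "chi i n \<noteq> 0" using nonzero[OF i \<open>coprime p M\<close>] by (simp add: pk power[OF i])
          ultimately show ?thesis using range[OF i, of n] e[OF i] by (auto simp: pk power[OF i])
        qed
        show False
        proof (cases "even k")
          case True
          then obtain j where "k = 2 * j" by blast
          hence "n = (p ^ j)\<^sup>2" by (simp add: pk power_mult[symmetric] mult.commute)
          moreover have "p ^ j \<in> {1..x}"
          proof -
            have "p ^ j \<le> p ^ k" using \<open>k = 2 * j\<close> prime_gt_0_nat[OF pk(1)] by (intro power_increasing) auto
            thus ?thesis using n pk prime_gt_0_nat[OF pk(1)] by auto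
          qed
          ultimately show False using n by (auto simp: B_def)
        next
          case False
          have "chi i p = e i" if i: "i \<in> I" for i
            using val[OF i] range[OF i, of p] False by (auto simp: power_0_left split: if_splits)
          thus False using no pk(1) \<open>\<not> p dvd M\<close> by blast
        qed
      qed
      have nonneg: "0 \<le> mangoldt n / real n" for n using mangoldt_nonneg[of n] by simp
      have "S x = (\<Sum>n\<in>{1..x} \<inter> (A \<union> B). w n * (mangoldt n / n))"
        unfolding S_def using vanish by (intro sum.mono_neutral_right) auto
      also have "\<dots> \<le> (\<Sum>n\<in>A \<union> B. w n * (mangoldt n / n))"
        using fin w_bounds nonneg by (intro sum_mono2 mult_nonneg_nonneg) auto
      also have "\<dots> \<le> (\<Sum>n\<in>A \<union> B. 2 ^ card I * (mangoldt n / n))"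
        using w_bounds nonneg by (intro sum_mono mult_right_mono) auto
      also have "\<dots> = 2 ^ card I * (\<Sum>n\<in>A \<union> B. mangoldt n / n)" by (simp only: sum_distrib_left)
      also have "(\<Sum>n\<in>A \<union> B. mangoldt n / n) \<le> (\<Sum>n\<in>A. mangoldt n / n) + (\<Sum>n\<in>B. mangoldt n / n)"
        using sum.union_inter[OF fin, of "\<lambda>n. mangoldt n / real n"]
          sum_nonneg[of "A \<inter> B" "\<lambda>n. mangoldt n / real n"] nonneg by simp
      also have "\<dots> \<le> (\<Sum>p\<in>P. ln (real p)) + C"
        unfolding A_def B_def by (intro add_mono C sum_mangoldt_prime_powers_le P)
      finally show ?thesis by simp
    qed
    thus ?thesis using that by blast
  qed

  obtain x :: nat where x: "exp (C1 + C2 + 1) \<le> real x" using real_arch_simple by blast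
  define y where "y = max x 2"
  have "C1 + C2 + 1 \<le> ln (real y)"
    using x by (subst ln_ge_iff) (auto simp: y_def)
  thus False using C1[of y] C2[of y] by (simp add: y_def)
qed

section \<open>Primes with prescribed Legendre symbols\<close>

lemma Legendre_range: "Legendre a p \<in> {-1, 0, 1}"
  by (simp add: Legendre_def)

text \<open>Turns Euler's criterion into equalities: two such values differ by at most 2, less than
  p.\<close>

lemma cong_imp_eq_if_small:
  fixes a b :: int
  assumes "[a = b] (mod int p)" "2 < p" "a \<in> {-1, 0, 1}" "b \<in> {-1, 0, 1}"
  shows "a = b"
proof -
  have "int p dvd a - b" using assms(1) by (simp add: cong_iff_dvd_diff)
  moreover have "\<bar>a - b\<bar> < \<bar>int p\<bar>" using assms by auto
  ultimately have "a - b = 0" using dvd_imp_le_int[of "a - b" "int p"] by linarith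
  thus ?thesis by simp
qed

lemma Legendre_mult:
  assumes "prime p" "2 < p"
  shows "Legendre (a * b) (int p) = Legendre a (int p) * Legendre b (int p)"
proof (rule cong_imp_eq_if_small[OF _ assms(2)])
  have "[Legendre a p * Legendre b p = (a * b) ^ ((p - 1) div 2)] (mod int p)"
    unfolding power_mult_distrib using assms by (intro cong_mult euler_criterion)
  thus "[Legendre (a * b) (int p) = Legendre a (int p) * Legendre b (int p)] (mod int p)"
    using cong_trans[OF euler_criterion[OF assms] cong_sym] by blast
qed (use Legendre_range[of a p] Legendre_range[of b p] in \<open>auto simp: Legendre_def\<close>)

lemma Legendre_cong: "[a = b] (mod p) \<Longrightarrow> Legendre a p = Legendre b p"
  by (simp add: Legendre_def QuadRes_def cong_def)

lemma Legendre_one: "p > 1 \<Longrightarrow> Legendre 1 p = 1"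
proof -
  assume "p > 1"
  hence "\<not> [1 = 0] (mod p)" by (simp add: cong_def)
  moreover have "QuadRes p 1" unfolding QuadRes_def by (rule exI[of _ 1]) simp
  ultimately show ?thesis by (simp add: Legendre_def)
qed

lemma Legendre_eq_1D: "Legendre a p = 1 \<Longrightarrow> QuadRes p a"
  by (auto simp: Legendre_def split: if_splits)

text \<open>Squaring identifies 1 and p - 1, so on the finite set of nonzero residues it is not
  injective and therefore not surjective.\<close>

lemma exists_quadratic_nonresidue:
  assumes p: "prime p" "2 < p"
  shows "\<exists>r. Legendre (int r) (int p) = -1"
proof -
  define f where "f x = x\<^sup>2 mod p" for x :: nat
  have "f 1 = f (p - 1)"
  proof -
    obtain k where "p = k + 2" using p by (metis add.commute le_Suc_ex less_imp_le_nat)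
    hence "(p - 1)\<^sup>2 = 1 + p * (p - 2)" by (simp add: power2_eq_square algebra_simps)
    moreover have "(1 + p * (p - 2)) mod p = 1 mod p" by (rule mod_mult_self2)
    ultimately show ?thesis unfolding f_def by (metis one_power2)
  qed
  moreover have "1 \<in> {1..<p}" "p - 1 \<in> {1..<p}" "1 \<noteq> p - 1" using p by auto
  ultimately have "\<not> inj_on f {1..<p}" unfolding inj_on_def by blast
  hence "card (f ` {1..<p}) \<noteq> card {1..<p}" using eq_card_imp_inj_on by blast
  hence "f ` {1..<p} \<noteq> {1..<p}" by metis
  moreover have "f ` {1..<p} \<subseteq> {1..<p}"
  proof
    fix y assume "y \<in> f ` {1..<p}"
    then obtain x where x: "y = x\<^sup>2 mod p" "1 \<le> x" "x < p" by (auto simp: f_def)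
    have "\<not> p dvd x" using x by (auto dest: dvd_imp_le)
    hence "\<not> p dvd x\<^sup>2" using p prime_dvd_power by blast
    thus "y \<in> {1..<p}" using x p by (simp add: dvd_eq_mod_eq_0 Suc_le_eq)
  qed
  ultimately obtain r where "r \<in> {1..<p}" and r3: "r \<notin> f ` {1..<p}" by blast
  hence r: "1 \<le> r" "r < p" by auto
  have "\<not> [int r = 0] (mod int p)" using r by (auto simp: cong_def)
  moreover have "\<not> QuadRes (int p) (int r)"
  proof
    assume "QuadRes (int p) (int r)"
    then obtain y where y: "[y\<^sup>2 = int r] (mod int p)" by (auto simp: QuadRes_def)
    define x where "x = nat (y mod int p)"
    have ix: "int x = y mod int p" using p by (simp add: x_def)
    have "[(int x)\<^sup>2 = int r] (mod int p)" using y by (simp add: ix cong_def power_mod)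
    hence "[x\<^sup>2 = r] (mod p)" by (simp add: cong_int_iff flip: of_nat_power)
    hence fx: "f x = r" using r by (simp add: f_def cong_def)
    moreover have "x \<noteq> 0" using fx r by (intro notI) (simp add: f_def)
    moreover have "int x < int p" using p by (simp add: ix)
    hence "x < p" by simp
    ultimately show False using r3 by (auto simp: image_iff)
  qed
  ultimately show ?thesis by (auto simp: Legendre_def)
qed

text \<open>\<open>chi4\<close> and \<open>chi8\<close> are the Kronecker symbols (-4/n) and (8/n),
  that is, the Legendre symbols of -1 and 2 when n is an odd prime. Together they separate the four
  odd classes modulo 8.\<close>

definition chi4 :: "nat \<Rightarrow> int" where
  "chi4 n = (if n mod 4 = 1 then 1 else if n mod 4 = 3 then -1 else 0)"

definition chi8 :: "nat \<Rightarrow> int" where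
  "chi8 n = (if n mod 8 \<in> {1, 7} then 1 else if n mod 8 \<in> {3, 5} then -1 else 0)"

lemma chi4_mult: "chi4 (m * n) = chi4 m * chi4 n"
proof -
  have "m mod 4 \<in> {0,1,2,3}" "n mod 4 \<in> {0,1,2,3}" by auto
  moreover have "(m * n) mod 4 = (m mod 4) * (n mod 4) mod 4" by (simp add: mod_mult_eq)
  ultimately show ?thesis by (elim insertE emptyE) (simp_all add: chi4_def)
qed

lemma chi8_mult: "chi8 (m * n) = chi8 m * chi8 n"
proof -
  have "m mod 8 \<in> {0,1,2,3,4,5,6,7}" "n mod 8 \<in> {0,1,2,3,4,5,6,7}" by auto
  moreover have "(m * n) mod 8 = (m mod 8) * (n mod 8) mod 8" by (simp add: mod_mult_eq)
  ultimately show ?thesis by (elim insertE emptyE) (simp_all add: chi8_def)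
qed

lemma mod_4_of_mod_8: "n mod 4 = n mod 8 mod (4::nat)"
  by (simp add: mod_mod_cancel)

lemma odd_mod_8: "odd n \<Longrightarrow> n mod 8 \<in> {1, 3, 5, 7 :: nat}"
  by simp presburger

lemma odd_mod_4: "odd n \<Longrightarrow> n mod 4 \<in> {1, 3 :: nat}"
  by simp presburger

lemma mod_8_eqI:
  assumes "odd r" "chi4 q = chi4 r" "chi8 q = chi8 r"
  shows "q mod 8 = r mod 8"
proof -
  have chi4: "chi4 n = (if n mod 8 \<in> {1, 5} then 1 else if n mod 8 \<in> {3, 7} then -1 else 0)" for n
  proof -
    have "n mod 4 = 1 \<longleftrightarrow> n mod 8 = 1 \<or> n mod 8 = 5" "n mod 4 = 3 \<longleftrightarrow> n mod 8 = 3 \<or> n mod 8 = 7"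
      by presburger+
    thus ?thesis by (simp add: chi4_def)
  qed
  show ?thesis using odd_mod_8[OF assms(1)] assms(2,3) unfolding chi4 chi8_def
    by (elim insertE emptyE) (auto split: if_splits)
qed

lemma chi4_eq_power:
  assumes "odd p"
  shows "chi4 p = (-1) ^ ((p - 1) div 2)"
proof -
  have "p mod 4 = 1 \<or> p mod 4 = 3" using assms by presburger
  thus ?thesis
  proof
    assume 1: "p mod 4 = 1"
    hence "even ((p - 1) div 2)" by presburger
    thus ?thesis using 1 by (simp add: chi4_def)
  next
    assume 3: "p mod 4 = 3"
    hence "odd ((p - 1) div 2)" by presburger
    thus ?thesis using 3 by (simp add: chi4_def)
  qed
qed

lemma Legendre_minus_one:
  assumes "prime p" "2 < p"
  shows "Legendre (-1) (int p) = chi4 p"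
proof (rule cong_imp_eq_if_small[OF _ assms(2)])
  have "odd p" using assms prime_odd_nat by blast
  thus "[Legendre (-1) (int p) = chi4 p] (mod int p)"
    using euler_criterion[OF assms, of "-1"] by (simp add: chi4_eq_power)
qed (auto simp: Legendre_def chi4_def)

lemma Legendre_two:
  assumes p: "prime p" "2 < p"
  shows "Legendre 2 (int p) = chi8 p"
proof -
  have odd: "odd p" using p prime_odd_nat by blast
  have "\<not> [2 = 0] (mod int p)" using p by (simp add: cong_def)
  then interpret GAUSS p 2 using p by unfold_locales auto
  define h where "h = (p - 1) div 2"
  have h: "(int p - 1) div 2 = int h" "int p = 2 * int h + 1"
    using odd p by (auto simp: h_def elim!: oddE)
  \<comment> \<open>For x \<le> h = (p - 1)/2 the product 2x is below p, so nothing is reduced and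
    Gauss's lemma merely counts the x with 2x > h.\<close>
  have "E = (\<lambda>x. 2 * int x) ` {h div 2 <.. h}"
  proof (intro equalityI subsetI)
    fix y assume "y \<in> E"
    then obtain x where x: "0 < x" "x \<le> int h" "y = (x * 2) mod int p" "int h < y"
      by (auto simp: E_def C_def B_def A_def h)
    hence y: "y = 2 * x" using h(2) by simp
    hence "h < 2 * nat x" using x by linarith
    hence "nat x \<in> {h div 2 <.. h}" using x by auto
    thus "y \<in> (\<lambda>x. 2 * int x) ` {h div 2 <.. h}" using y x by (auto intro!: image_eqI[of _ _ "nat x"])
  next
    fix y assume "y \<in> (\<lambda>x. 2 * int x) ` {h div 2 <.. h}"
    then obtain x where x: "y = 2 * int x" "h div 2 < x" "x \<le> h" by auto
    have y: "y = (int x * 2) mod int p" "int h < y" and "0 < int x" "int x \<le> int h" using x h(2) by simp_all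
    hence "int x * 2 \<in> B" unfolding B_def by (intro imageI) (simp add: A_def h)
    thus "y \<in> E" using y unfolding E_def C_def by (auto simp: h)
  qed
  hence "card E = h - h div 2" by (simp add: card_image inj_on_def)
  hence L: "Legendre 2 (int p) = (-1) ^ (h - h div 2)" using gauss_lemma by simp
  have "p mod 8 \<in> {1, 7} \<and> even (h - h div 2) \<or> p mod 8 \<in> {3, 5} \<and> odd (h - h div 2)"
  proof -
    define k r where "k = p div 8" "r = p mod 8"
    have pk: "p = 8 * k + r" by (simp add: k_r_def)
    have "r \<in> {1, 3, 5, 7}" using odd_mod_8[OF odd] by (simp add: k_r_def)
    thus ?thesis unfolding h_def k_r_def[symmetric]
      by (elim insertE emptyE; simp add: pk; presburger)
  qed
  thus ?thesis unfolding L by (auto simp: chi8_def)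
qed

section \<open>Prescribing several quadratic symbols at once\<close>

text \<open>The indices 1 and 2, which are not odd primes, are borrowed for the two characters
  modulo 8, so that one index set of naturals covers all symbols.\<close>

definition quad_symbol :: "nat \<Rightarrow> nat \<Rightarrow> int" where
  "quad_symbol i n = (if i = 1 then chi4 n else if i = 2 then chi8 n else Legendre (int n) (int i))"

text \<open>For the value -1, the Chinese remainder theorem supplies an argument at which exactly
  one chosen symbol of the product is -1 and the others are 1.\<close>

lemma real_nonprincipal_character_prod_quad_symbol:
  assumes S: "finite S" "\<And>p. p \<in> S \<Longrightarrow> prime p \<and> 2 < p"
    and J: "J \<subseteq> {1, 2} \<union> S" "J \<noteq> {}"
  shows "real_nonprincipal_character (\<lambda>n. \<Prod>i\<in>J. of_int (quad_symbol i n)) (8 * \<Prod>S)"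
proof
  have not12: "1 \<notin> S" "2 \<notin> S" using S(2) by fastforce+
  have finJ: "finite J" using S J finite_subset by fastforce
  have "0 < \<Prod>S" by (rule prod_pos) (use S(2) in fastforce)
  thus "0 < 8 * \<Prod>S" by simp
  have index: "i = 1 \<or> i = 2 \<or> i \<noteq> 1 \<and> i \<noteq> 2 \<and> i \<in> S \<and> prime i \<and> 2 < i" if "i \<in> J" for i
    using that J(1) S(2)[of i] not12 by blast
  have "quad_symbol i 1 = 1" if "i \<in> J" for i
    using index[OF that] by (auto simp: quad_symbol_def chi4_def chi8_def Legendre_one)
  thus "(\<Prod>i\<in>J. real_of_int (quad_symbol i 1)) = 1" by (intro prod.neutral) simp
  fix m n
  have "quad_symbol i (m * n) = quad_symbol i m * quad_symbol i n" if "i \<in> J" for i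
    using index[OF that] by (auto simp: quad_symbol_def chi4_mult chi8_mult Legendre_mult)
  thus "(\<Prod>i\<in>J. real_of_int (quad_symbol i (m * n))) =
      (\<Prod>i\<in>J. of_int (quad_symbol i m)) * (\<Prod>i\<in>J. of_int (quad_symbol i n))"
    by (simp add: prod.distrib)
  have range: "quad_symbol i n \<in> {-1, 0, 1}" for i
    using Legendre_range[of "int n" "int i"] by (auto simp: quad_symbol_def chi4_def chi8_def)
  show "(\<Prod>i\<in>J. real_of_int (quad_symbol i n)) \<in> {-1, 0, 1}"
    using finJ
  proof (induction J rule: finite_induct)
    case (insert i J)
    thus ?case using range[of i] by auto
  qed simp
  have "quad_symbol i (n + 8 * \<Prod>S) = quad_symbol i n" if "i \<in> J" for i
  proof -
    consider "i = 1" | "i = 2" | "i \<in> S" "i \<noteq> 1" "i \<noteq> 2" using index[OF \<open>i \<in> J\<close>] by blast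
    thus ?thesis
    proof cases
      case 1
      have "(n + 8 * \<Prod>S) mod 4 = n mod 4" by presburger
      thus ?thesis using 1 by (simp add: quad_symbol_def chi4_def)
    next
      case 3
      have "i dvd \<Prod>S" using 3 dvd_prodI[OF S(1), of i "\<lambda>x. x"] by simp
      hence "[int (n + 8 * \<Prod>S) = int n] (mod int i)"
        by (simp add: cong_iff_dvd_diff del: of_nat_prod)
      thus ?thesis using 3 Legendre_cong by (simp add: quad_symbol_def del: of_nat_add)
    qed (simp add: quad_symbol_def chi8_def)
  qed
  thus "(\<Prod>i\<in>J. real_of_int (quad_symbol i (n + 8 * \<Prod>S))) = (\<Prod>i\<in>J. of_int (quad_symbol i n))"
    by simp
  obtain i where i: "i \<in> J" using J by blast
  obtain r where r: "\<And>p. p \<in> S \<Longrightarrow> Legendre (int (r p)) (int p) = -1"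
    using exists_quadratic_nonresidue S(2) by metis
  \<comment> \<open>Index 0 stands for the modulus 8. The class 7 has \<open>chi4\<close> = -1 and
    \<open>chi8\<close> = 1, the class 5 has \<open>chi4\<close> = 1 and \<open>chi8\<close> = -1,
    and at 1 both are 1.\<close>
  define u where "u j = (if j = 0 then (if i = 1 then 7 else if i = 2 then 5 else 1)
      else if j = i then r j else 1)" for j :: nat
  define md where "md j = (if j = 0 then 8 else j)" for j :: nat
  have "\<exists>a. \<forall>j\<in>insert 0 S. [a = u j] (mod md j)"
  proof (rule chinese_remainder_nat)
    have 8: "coprime (8::nat) p" if "p \<in> S" for p
    proof -
      have "coprime 2 p" using S(2)[OF that] primes_coprime[of 2 p] by auto
      hence "coprime (2 ^ 3) p" by (simp only: coprime_power_left_iff) simp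
      thus ?thesis by simp
    qed
    have p0: "p \<noteq> 0" if "p \<in> S" for p using S(2)[OF that] by simp
    show "\<forall>i\<in>insert 0 S. \<forall>j\<in>insert 0 S. i \<noteq> j \<longrightarrow> coprime (md i) (md j)"
    proof (intro ballI impI)
      fix i j assume ij: "i \<in> insert 0 S" "j \<in> insert 0 S" "i \<noteq> j"
      then consider "i = 0" "j \<in> S" | "i \<in> S" "j = 0" | "i \<in> S" "j \<in> S" by blast
      thus "coprime (md i) (md j)"
      proof cases
        case 1
        thus ?thesis using 8[of j] p0[of j] by (simp add: md_def)
      next
        case 2
        thus ?thesis using 8[of i] p0[of i] by (simp add: md_def coprime_commute)
      next
        case 3
        thus ?thesis using primes_coprime[of i j] S(2) ij(3) p0[OF 3(1)] p0[OF 3(2)] by (simp add: md_def)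
      qed
    qed
  qed (use S in auto)
  then obtain a where a: "\<And>j. j \<in> insert 0 S \<Longrightarrow> [a = u j] (mod md j)" by blast
  have a8: "[a = u 0] (mod 8)" using a[of 0] by (simp add: md_def)
  have ap: "[int a = int (u p)] (mod int p)" if "p \<in> S" for p
    using a[of p] that S(2)[OF that] by (simp add: md_def cong_int_iff)
  have val: "quad_symbol j a = (if j = i then -1 else 1)" if "j \<in> J" for j
  proof -
    consider "j = 1" | "j = 2" | "j \<in> S" "j \<noteq> 1" "j \<noteq> 2" using index[OF \<open>j \<in> J\<close>] by blast
    thus ?thesis
    proof cases
      case 1
      have "a mod 8 = u 0 mod 8" using a8 by (simp add: cong_def)
      thus ?thesis using 1 mod_4_of_mod_8[of a]
        by (simp add: quad_symbol_def chi4_def u_def split: if_splits)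
    next
      case 2
      have "a mod 8 = u 0 mod 8" using a8 by (simp add: cong_def)
      thus ?thesis using 2 by (simp add: quad_symbol_def chi8_def u_def split: if_splits)
    next
      case 3
      thus ?thesis using Legendre_cong[OF ap[OF 3(1)]] r[OF 3(1)] S(2)[OF 3(1)]
        by (auto simp: quad_symbol_def u_def Legendre_one)
    qed
  qed
  have "(\<Prod>j\<in>J. real_of_int (quad_symbol j a)) = (\<Prod>j\<in>J. if j = i then -1 else 1)"
    using val by (intro prod.cong) auto
  also have "\<dots> = -1" using i finJ by (simp add: prod.delta)
  finally have prod: "(\<Prod>j\<in>J. real_of_int (quad_symbol j a)) = -1" .
  have "coprime a (8 * \<Prod>S)"
  proof -
    have "a mod 8 = 7 \<or> a mod 8 = 5 \<or> a mod 8 = 1" using a8 by (simp add: cong_def u_def split: if_splits)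
    hence "odd a" by presburger
    hence "coprime a (2 ^ 3)" by (simp only: coprime_power_right_iff) simp
    moreover have "coprime a p" if p: "p \<in> S" for p
    proof -
      have "\<not> p dvd a"
      proof
        assume "p dvd a"
        hence "[int (u p) = 0] (mod int p)" using ap[OF p]
          by (metis cong_0_iff cong_sym cong_trans int_dvd_int_iff)
        hence "Legendre (int (u p)) (int p) = 0" by (simp add: Legendre_def)
        thus False using r[OF p] S(2)[OF p] by (auto simp: u_def Legendre_one split: if_splits)
      qed
      thus ?thesis using S(2)[OF p] prime_imp_coprime coprime_commute by blast
    qed
    hence "coprime a (\<Prod>S)" by (intro prod_coprime_right) auto
    ultimately show ?thesis by simp
  qed
  thus "\<exists>a. coprime a (8 * \<Prod>S) \<and> (\<Prod>j\<in>J. real_of_int (quad_symbol j a)) = -1" using prod by blast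
qed

theorem exists_prime_with_Legendre_symbols:
  fixes e :: "nat \<Rightarrow> int" and r :: nat
  assumes S: "finite S" "\<And>p. p \<in> S \<Longrightarrow> prime p \<and> 2 < p" and r: "odd r"
    and e: "\<And>p. p \<in> S \<Longrightarrow> e p = 1 \<or> e p = -1"
  shows "\<exists>q. prime q \<and> [q = r] (mod 8) \<and> q \<notin> S \<and> (\<forall>p\<in>S. Legendre (int q) (int p) = e p)"
proof -
  define M where "M = 8 * \<Prod>S"
  have not12: "1 \<notin> S" "2 \<notin> S" using S(2) by fastforce+
  define d where "d i = (if i = 1 then chi4 r else if i = 2 then chi8 r else e i)" for i
  have "\<exists>q. prime q \<and> \<not> q dvd M \<and> (\<forall>i\<in>{1,2} \<union> S. real_of_int (quad_symbol i q) = real_of_int (d i))"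
  proof (rule exists_prime_with_character_values)
    show "finite ({1, 2} \<union> S)" using S by simp
    have "0 < \<Prod>S" by (rule prod_pos) (use S(2) in fastforce)
    thus "0 < M" by (simp add: M_def)
    show "real_nonprincipal_character (\<lambda>n. \<Prod>i\<in>J. real_of_int (quad_symbol i n)) M"
      if "J \<subseteq> {1, 2} \<union> S" "J \<noteq> {}" for J
      unfolding M_def by (rule real_nonprincipal_character_prod_quad_symbol) (use S that in auto)
    show "real_of_int (quad_symbol i n) \<noteq> 0" if "i \<in> {1, 2} \<union> S" "coprime n M" for i n
    proof -
      have "odd n"
      proof
        assume "even n"
        hence "2 dvd gcd n M" by (simp add: M_def)
        thus False using that(2) by simp
      qed
      hence "n mod 8 \<in> {1, 3, 5, 7}" "n mod 4 \<in> {1, 3}" by (rule odd_mod_8, rule odd_mod_4)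
      hence "chi4 n \<noteq> 0" "chi8 n \<noteq> 0" by (auto simp: chi4_def chi8_def)
      moreover have "Legendre (int n) (int i) \<noteq> 0" if "i \<in> S"
      proof -
        have "i dvd M" using that dvd_prodI[OF S(1), of i "\<lambda>x. x"] by (simp add: M_def)
        hence "\<not> i dvd n" using \<open>coprime n M\<close> S(2)[OF that]
          by (metis coprime_common_divisor_nat less_irrefl prime_nat_iff)
        thus ?thesis by (simp add: Legendre_def cong_0_iff)
      qed
      ultimately show ?thesis using that(1) by (auto simp: quad_symbol_def)
    qed
    have "r mod 8 \<in> {1, 3, 5, 7}" "r mod 4 \<in> {1, 3}" using odd_mod_8[OF r] odd_mod_4[OF r] .
    hence "chi4 r = 1 \<or> chi4 r = -1" "chi8 r = 1 \<or> chi8 r = -1" by (auto simp: chi4_def chi8_def)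
    thus "real_of_int (d i) = 1 \<or> real_of_int (d i) = -1" if "i \<in> {1, 2} \<union> S" for i
      using e[of i] that by (auto simp: d_def)
  qed
  then obtain q where q: "prime q" "\<not> q dvd M" "\<And>i. i \<in> {1,2} \<union> S \<Longrightarrow> quad_symbol i q = d i"
    by auto
  have c: "chi4 q = chi4 r" "chi8 q = chi8 r" using q(3)[of 1] q(3)[of 2] by (simp_all add: quad_symbol_def d_def)
  have "q mod 8 = r mod 8" using mod_8_eqI[OF r c] .
  moreover have "q \<notin> S" using q(2) dvd_prodI[OF S(1), of q "\<lambda>x. x"] by (auto simp: M_def)
  moreover have "Legendre (int q) (int p) = e p" if "p \<in> S" for p
  proof -
    have "p \<noteq> 1" "p \<noteq> 2" using not12 that by auto
    thus ?thesis using q(3)[of p] that by (simp add: quad_symbol_def d_def)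
  qed
  ultimately show ?thesis using q(1) by (auto simp: cong_def)
qed

section \<open>Ternary quadratic forms\<close>

text \<open>Provides box sides: a is the least integer with a^2 \<ge> t, so differences within
  \<open>{0..<a}\<close> have squares strictly below t even when t is a square.\<close>

lemma ceiling_sqrt_int:
  fixes t :: int
  assumes "t \<ge> 1"
  obtains a where "a \<ge> 1" "t \<le> a\<^sup>2" "\<And>x. 0 \<le> x \<Longrightarrow> x < a \<Longrightarrow> x\<^sup>2 < t"
proof -
  define k where "k = (LEAST k. t \<le> (int k)\<^sup>2)"
  have "t \<le> (int (nat t))\<^sup>2"
    using assms self_le_power[of t 2] by simp
  hence k: "t \<le> (int k)\<^sup>2" unfolding k_def by (rule LeastI)
  have min: "x\<^sup>2 < t" if "0 \<le> x" "x < int k" for x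
  proof -
    have "nat x < k" using that by linarith
    hence "\<not> t \<le> (int (nat x))\<^sup>2" unfolding k_def by (rule not_less_Least)
    thus ?thesis using that by simp
  qed
  have "k \<noteq> 0" using k assms by (intro notI) simp
  hence "int k \<ge> 1" by simp
  from that[OF this k min] show ?thesis by blast
qed

text \<open>
  If the pigeonhole argument yields \<open>Z\<^sup>2 + t Y\<^sup>2 - N X\<^sup>2 = N t\<close> instead of \<open>0\<close>, multiply
  \<open>Z\<^sup>2 + t Y\<^sup>2 = N (X\<^sup>2 + t)\<close> by \<open>X\<^sup>2 + t\<close> and use multiplicativity of the norm form.
\<close>
lemma norm_form_represents_multiple:
  fixes t N \<alpha> \<beta> :: int
  assumes t: "t \<ge> 1" and N: "N \<ge> 1" and cop: "coprime N t"
    and \<alpha>: "N dvd \<alpha>\<^sup>2 + t" and \<beta>: "t dvd \<beta>\<^sup>2 - N"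
  shows "\<exists>X Y Z. X \<noteq> 0 \<and> N * X\<^sup>2 = Z\<^sup>2 + t * Y\<^sup>2"
proof -
  obtain a where a: "a \<ge> 1" "t \<le> a\<^sup>2" "\<And>x. 0 \<le> x \<Longrightarrow> x < a \<Longrightarrow> x\<^sup>2 < t"
    using ceiling_sqrt_int[OF t] by blast
  obtain b where b: "b \<ge> 1" "N \<le> b\<^sup>2" "\<And>x. 0 \<le> x \<Longrightarrow> x < b \<Longrightarrow> x\<^sup>2 < N"
    using ceiling_sqrt_int[OF N] by blast
  have Nt: "N * t \<ge> 1" using t N by (smt (verit) mult_pos_pos)
  \<comment> \<open>The extra 1 makes the box strictly larger than the number N t of residue pairs;
    Z^2 can then be as large as N t.\<close>
  hence "N * t + 1 \<ge> 1" by simp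
  from ceiling_sqrt_int[OF this]
  obtain c where c: "c \<ge> 1" "N * t + 1 \<le> c\<^sup>2" "\<And>x. 0 \<le> x \<Longrightarrow> x < c \<Longrightarrow> x\<^sup>2 < N * t + 1"
    by metis
  have "(N * t)\<^sup>2 < (a * b * c)\<^sup>2"
  proof -
    have "t * N \<le> a\<^sup>2 * b\<^sup>2" using a b t N by (intro mult_mono) auto
    moreover have "N * t < c\<^sup>2" using c by linarith
    ultimately have "(N * t) * (N * t) < (a\<^sup>2 * b\<^sup>2) * c\<^sup>2"
      using Nt by (intro mult_le_less_imp_less) (auto simp: mult.commute)
    thus ?thesis by (simp add: power2_eq_square mult_ac)
  qed
  moreover have "0 \<le> a * b * c" using a b c by simp
  ultimately have abc: "N * t < a * b * c" by (rule power2_less_imp_less)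
  define S where "S = {0..<a} \<times> {0..<b} \<times> {0..<c}"
  \<comment> \<open>A collision gives Z = \<alpha> Y modulo N and Z = \<beta> X modulo t, which
    makes Z^2 + t Y^2 - N X^2 divisible by N and by t.\<close>
  define f where "f = (\<lambda>(x, y, z). ((z - \<alpha> * y) mod N, (z - \<beta> * x) mod t))"
  have "f ` S \<subseteq> {0..<N} \<times> {0..<t}" using t N by (auto simp: f_def)
  hence "card (f ` S) \<le> card ({0..<N} \<times> {0..<t})" by (intro card_mono) auto
  also have "\<dots> = nat (N * t)" using t N by (simp add: nat_mult_distrib)
  also have "\<dots> < nat (a * b * c)" using abc Nt by linarith
  also have "\<dots> = card S" using a b c by (simp add: S_def nat_mult_distrib)
  finally have "\<not> inj_on f S" by (rule pigeonhole)
  then obtain p q where pq: "p \<in> S" "q \<in> S" "p \<noteq> q" "f p = f q"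
    unfolding inj_on_def by blast
  obtain x1 y1 z1 where p: "p = (x1, y1, z1)" by (cases p)
  obtain x2 y2 z2 where q: "q = (x2, y2, z2)" by (cases q)
  define X Y Z where XYZ: "X = x1 - x2" "Y = y1 - y2" "Z = z1 - z2"
  have bound: "(u - v)\<^sup>2 < m"
    if "\<And>x. 0 \<le> x \<Longrightarrow> x < k \<Longrightarrow> x\<^sup>2 < m" "u \<in> {0..<k}" "v \<in> {0..<k}" for u v k m :: int
  proof -
    have "\<bar>u - v\<bar>\<^sup>2 < m" using that(2,3) by (intro that(1)) auto
    thus ?thesis by simp
  qed
  have in_box: "x1 \<in> {0..<a}" "x2 \<in> {0..<a}" "y1 \<in> {0..<b}" "y2 \<in> {0..<b}" "z1 \<in> {0..<c}" "z2 \<in> {0..<c}"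
    using pq p q by (auto simp: S_def)
  have X: "X\<^sup>2 < t" unfolding XYZ by (rule bound[OF a(3)]) (use in_box in auto)
  have Y: "Y\<^sup>2 < N" unfolding XYZ by (rule bound[OF b(3)]) (use in_box in auto)
  have Z: "Z\<^sup>2 < N * t + 1" unfolding XYZ by (rule bound[OF c(3)]) (use in_box in auto)
  have nz: "\<not> (X = 0 \<and> Y = 0 \<and> Z = 0)" using pq(3) by (auto simp: XYZ p q)
  have "N dvd (z1 - \<alpha> * y1) - (z2 - \<alpha> * y2)" "t dvd (z1 - \<beta> * x1) - (z2 - \<beta> * x2)"
    using pq(4) by (simp_all add: f_def p q mod_eq_dvd_iff)
  hence dN: "N dvd Z - \<alpha> * Y" and dt: "t dvd Z - \<beta> * X"
    by (simp_all add: XYZ algebra_simps)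
  define F where "F = Z\<^sup>2 + t * Y\<^sup>2 - N * X\<^sup>2"
  have "F = (Z - \<alpha> * Y) * (Z + \<alpha> * Y) + (\<alpha>\<^sup>2 + t) * Y\<^sup>2 - N * X\<^sup>2"
    by (simp add: F_def algebra_simps power2_eq_square)
  hence "N dvd F" using dN \<alpha> by simp
  moreover have "F = (Z - \<beta> * X) * (Z + \<beta> * X) + (\<beta>\<^sup>2 - N) * X\<^sup>2 + t * Y\<^sup>2"
    by (simp add: F_def algebra_simps power2_eq_square)
  hence "t dvd F" using dt \<beta> by simp
  ultimately have "N * t dvd F" using cop divides_mult by blast
  then obtain k where k: "F = N * t * k" by (elim dvdE)
  have NX: "N * X\<^sup>2 < N * t" using X N by simp
  have tY: "t * Y\<^sup>2 < N * t" using Y t by (simp add: mult.commute)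
  have "0 \<le> N * X\<^sup>2" "0 \<le> t * Y\<^sup>2" using t N by simp_all
  \<comment> \<open>Only the multiples 0 and N t lie in this open interval.\<close>
  hence "- (N * t) < F" "F < 2 * (N * t)"
    using NX tY Z zero_le_power2[of Z] unfolding F_def by linarith+
  hence "(N * t) * (-1) < (N * t) * k" "(N * t) * k < (N * t) * 2" using k by auto
  hence "-1 < k" "k < 2" using Nt by (simp_all only: mult_less_cancel_left_pos)
  then consider "k = 0" | "k = 1" by linarith
  thus ?thesis
  proof cases
    case 1
    hence eq: "N * X\<^sup>2 = Z\<^sup>2 + t * Y\<^sup>2" using k by (simp add: F_def)
    have "X \<noteq> 0"
    proof
      assume "X = 0"
      moreover have "0 \<le> t * Y\<^sup>2" using t by simp
      moreover have "Z\<^sup>2 + t * Y\<^sup>2 = 0" using eq \<open>X = 0\<close> by simp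
      ultimately have "Z\<^sup>2 = 0" "t * Y\<^sup>2 = 0" using zero_le_power2[of Z] by linarith+
      thus False using \<open>X = 0\<close> nz t by simp
    qed
    thus ?thesis using eq by blast
  next
    case 2
    hence eq: "Z\<^sup>2 + t * Y\<^sup>2 = N * (X\<^sup>2 + t)" using k by (simp add: F_def algebra_simps)
    have "N * (X\<^sup>2 + t)\<^sup>2 = (Z\<^sup>2 + t * Y\<^sup>2) * (X\<^sup>2 + t)"
      unfolding eq by (simp only: power2_eq_square mult.assoc)
    also have "\<dots> = (Z * X - t * Y)\<^sup>2 + t * (Z + X * Y)\<^sup>2"
      by (simp add: algebra_simps power2_eq_square)
    finally have "N * (X\<^sup>2 + t)\<^sup>2 = (Z * X - t * Y)\<^sup>2 + t * (Z + X * Y)\<^sup>2" .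
    moreover have "X\<^sup>2 + t > 0" using t by (simp add: add_nonneg_pos)
    ultimately show ?thesis by (metis less_irrefl)
  qed
qed

section \<open>The Davenport--Cassels descent\<close>

text \<open>One family for both forms: \<open>e = 0\<close> is the sum of three squares,
  \<open>e = 1\<close> a square plus the norm form of the Eisenstein integers. The descent treats
  them together.\<close>

definition qform :: "int \<Rightarrow> int \<Rightarrow> int \<Rightarrow> int \<Rightarrow> int" where
  "qform e x y z = x\<^sup>2 + y\<^sup>2 + e * y * z + z\<^sup>2"

lemma round_down:
  fixes t y :: int assumes "t > 0"
  obtains b r where "y = t * b + r" "- t \<le> 2 * r" "2 * r < t"
proof -
  define b where "b = (2 * y + t) div (2 * t)"
  define r where "r = y - t * b"
  have "2 * y + t = 2 * t * b + (2 * y + t) mod (2 * t)" by (simp add: b_def)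
  hence "2 * r + t = (2 * y + t) mod (2 * t)" unfolding r_def by (simp add: algebra_simps)
  moreover have "0 \<le> (2 * y + t) mod (2 * t)" "(2 * y + t) mod (2 * t) < 2 * t" using assms by simp_all
  ultimately have "- t \<le> 2 * r" "2 * r < t" by linarith+
  thus ?thesis using that[of b r] by (simp add: r_def)
qed

lemma square_le_of_abs_le: fixes a t :: int assumes "-t \<le> a" "a \<le> t" shows "a\<^sup>2 \<le> t\<^sup>2"
  using assms abs_le_square_iff[of a t] by linarith

text \<open>
  The Davenport--Cassels descent. The residues of the last two coordinates are rounded in
  opposite directions, which excludes the one case where the distance would be \<open>1\<close>.
\<close>
lemma qform_integral_of_rational:
  fixes t :: int
  assumes e: "e = 0 \<or> e = 1" and "t > 0" and "N * t\<^sup>2 = qform e x y z"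
  shows "\<exists>x y z. N = qform e x y z"
  using assms(2,3)
proof (induction "nat t" arbitrary: t x y z rule: less_induct)
  case less
  note t = \<open>t > 0\<close> and eq = \<open>N * t\<^sup>2 = qform e x y z\<close>
  obtain a r where x: "x = t * a + r" "- t \<le> 2 * r" "2 * r < t" using round_down[OF t] .
  obtain b s where y: "y = t * b + s" "- t \<le> 2 * s" "2 * s < t" using round_down[OF t] .
  obtain c' u' where z': "- z = t * c' + u'" "- t \<le> 2 * u'" "2 * u' < t" using round_down[OF t] .
  define c u where "c = - c'" "u = - u'"
  have z: "z = t * c + u" "- t < 2 * u" "2 * u \<le> t" using z' by (auto simp: c_u_def)
  have r2: "4 * r\<^sup>2 \<le> t\<^sup>2" using square_le_of_abs_le[of t "2 * r"] x by (simp add: power_mult_distrib)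
  have s2: "4 * s\<^sup>2 \<le> t\<^sup>2" using square_le_of_abs_le[of t "2 * s"] y by (simp add: power_mult_distrib)
  have u2: "4 * u\<^sup>2 \<le> t\<^sup>2" using square_le_of_abs_le[of t "2 * u"] z by (simp add: power_mult_distrib)
  \<comment> \<open>Equality would force s = u with 2s = t or 2s = -t, but 2s = t is excluded for s
    and 2u = -t for u by the opposite roundings.\<close>
  have su: "4 * (s * u) < t\<^sup>2"
  proof (rule ccontr)
    assume "\<not> ?thesis"
    moreover have "4 * (s - u)\<^sup>2 = 4 * s\<^sup>2 + 4 * u\<^sup>2 - 2 * (4 * (s * u))"
      by (simp add: power2_eq_square algebra_simps)
    ultimately have "4 * (s - u)\<^sup>2 \<le> 0" "4 * u\<^sup>2 = t\<^sup>2"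
      using s2 u2 zero_le_power2[of "s - u"] by linarith+
    hence "s = u" "(2 * u)\<^sup>2 = t\<^sup>2" by (simp_all add: power_mult_distrib)
    hence "2 * u = t \<or> 2 * u = - t" by (simp only: power2_eq_iff)
    thus False using y z \<open>s = u\<close> by auto
  qed
  have R4: "4 * qform e r s u < 4 * t\<^sup>2"
  proof -
    have t2: "t\<^sup>2 > 0" using t by simp
    show ?thesis using e
    proof
      assume "e = 0"
      hence "4 * qform e r s u = 4 * r\<^sup>2 + 4 * s\<^sup>2 + 4 * u\<^sup>2" by (simp add: qform_def)
      thus ?thesis using r2 s2 u2 t2 by linarith
    next
      assume "e = 1" thus ?thesis using r2 s2 u2 su unfolding qform_def by simp
    qed
  qed
  have nonneg: "0 \<le> qform e r s u" and pos: "qform e r s u = 0 \<Longrightarrow> r = 0 \<and> s = 0 \<and> u = 0"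
  proof -
    have *: "2 * qform e r s u = 2 * r\<^sup>2 + s\<^sup>2 + u\<^sup>2 + (s + u)\<^sup>2" if "e = 1"
      using that by (simp add: qform_def power2_eq_square algebra_simps)
    have **: "qform e r s u = r\<^sup>2 + s\<^sup>2 + u\<^sup>2" if "e = 0" using that by (simp add: qform_def)
    show "0 \<le> qform e r s u" using e * **
      by (smt (verit) zero_le_power2)
    show "r = 0 \<and> s = 0 \<and> u = 0" if "qform e r s u = 0"
      using e
    proof
      assume "e = 0"
      hence "r\<^sup>2 + s\<^sup>2 + u\<^sup>2 = 0" using ** that by simp
      hence "r\<^sup>2 = 0" "s\<^sup>2 = 0" "u\<^sup>2 = 0"
        using zero_le_power2[of r] zero_le_power2[of s] zero_le_power2[of u] by linarith+
      thus ?thesis by simp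
    next
      assume "e = 1"
      hence "2 * r\<^sup>2 + s\<^sup>2 + u\<^sup>2 + (s + u)\<^sup>2 = 0" using * that by simp
      hence "r\<^sup>2 = 0" "s\<^sup>2 = 0" "u\<^sup>2 = 0"
        using zero_le_power2[of r] zero_le_power2[of s] zero_le_power2[of u] zero_le_power2[of "s+u"] by linarith+
      thus ?thesis by simp
    qed
  qed
  \<comment> \<open>B is the polar form of (x, y, z) and (a, b, c). The line through (x, y, z)/t and
    (a, b, c) meets the quadric of value N a second time at (A v + D w)/t', where v = (x, y, z) and
    w = (a, b, c); the new denominator is t' = \<open>qform e r s u\<close> / t < t.\<close>
  define B where "B = 2 * x * a + 2 * y * b + e * (y * c + z * b) + 2 * z * c"
  define A where "A = qform e a b c - N"
  define D where "D = 2 * N * t - B"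
  define t' where "t' = A * t + D"
  have tt': "t * t' = qform e r s u"
  proof -
    have "qform e r s u = qform e x y z - t * B + t\<^sup>2 * qform e a b c"
      unfolding x y z B_def qform_def by (simp add: power2_eq_square algebra_simps)
    also have "\<dots> = t * t'" unfolding t'_def A_def D_def eq[symmetric]
      by (simp add: power2_eq_square algebra_simps)
    finally show ?thesis by simp
  qed
  show ?case
  proof (cases "qform e r s u = 0")
    case True
    hence "x = t * a" "y = t * b" "z = t * c" using pos x y z by auto
    hence "N * t\<^sup>2 = qform e a b c * t\<^sup>2" using eq by (simp add: qform_def power2_eq_square algebra_simps)
    hence "N = qform e a b c" using t by simp
    thus ?thesis by blast
  next
    case False
    hence "0 < t * t'" using nonneg tt' by simp
    hence t'pos: "t' > 0" using t by (simp add: zero_less_mult_iff)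
    have "t * t' < t * t" using tt' R4 by (simp add: power2_eq_square)
    hence "t' < t" using t by simp
    have "qform e (A * x + D * a) (A * y + D * b) (A * z + D * c)
        = A\<^sup>2 * qform e x y z + A * D * B + D\<^sup>2 * qform e a b c"
      unfolding B_def qform_def by (simp add: power2_eq_square algebra_simps)
    also have "\<dots> = A\<^sup>2 * (N * t\<^sup>2) + A * D * (2 * N * t - D) + D\<^sup>2 * (A + N)"
      by (simp add: eq A_def D_def)
    also have "\<dots> = N * t'\<^sup>2" by (simp add: t'_def power2_eq_square algebra_simps)
    finally show ?thesis using less.hyps[of t'] t'pos \<open>t' < t\<close>
      by (metis zless_nat_conj t)
  qed
qed

section \<open>Quadratic residues modulo composite numbers, and reciprocity\<close>

lemma QuadRes_mult_coprime:
  assumes "coprime m n" "QuadRes m a" "QuadRes n a"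
  shows "QuadRes (m * n) a"
proof -
  obtain x y where x: "[x\<^sup>2 = a] (mod m)" and y: "[y\<^sup>2 = a] (mod n)"
    using assms by (auto simp: QuadRes_def)
  obtain z where z: "[z = x] (mod m)" "[z = y] (mod n)"
    using binary_chinese_remainder_int[OF assms(1)] by blast
  have "[z\<^sup>2 = a] (mod m)" "[z\<^sup>2 = a] (mod n)"
    using cong_trans[OF cong_pow[OF z(1)] x] cong_trans[OF cong_pow[OF z(2)] y] .
  hence "[z\<^sup>2 = a] (mod (m * n))" using assms(1) by (simp add: cong_iff_dvd_diff divides_mult)
  thus ?thesis by (auto simp: QuadRes_def)
qed

lemma coprime_primeI: "prime q \<Longrightarrow> \<not> q dvd n \<Longrightarrow> coprime n (q :: nat)"
  using prime_imp_coprime coprime_commute by blast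

lemma QuadRes_1: "QuadRes 1 a"
  by (simp add: QuadRes_def)

lemma QuadRes_2: "QuadRes 2 a"
proof -
  have "2 dvd a\<^sup>2 - a" by simp
  thus ?thesis unfolding QuadRes_def cong_iff_dvd_diff by blast
qed

lemma nat_prime_factor_induct [consumes 1, case_names 1 mult]:
  assumes "n > 0" and 1: "P 1" and "\<And>p m. prime p \<Longrightarrow> m > 0 \<Longrightarrow> P m \<Longrightarrow> P (p * m)"
  shows "P (n :: nat)"
  using assms(1)
proof (induction n rule: less_induct)
  case (less n)
  show ?case
  proof (cases "n = 1")
    case False
    then obtain p m where p: "prime p" "n = p * m" using prime_factor_nat by blast
    hence "m > 0" "m < n" using less.prems prime_gt_1_nat[OF p(1)] by auto
    thus ?thesis using p assms(3) less.IH by blast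
  qed (use 1 in simp)
qed

lemma QuadRes_squarefree:
  assumes "n > 0" "squarefree (n :: nat)" "\<And>p. prime p \<Longrightarrow> p dvd n \<Longrightarrow> QuadRes (int p) a"
  shows "QuadRes (int n) a"
  using assms
proof (induction n rule: nat_prime_factor_induct)
  case (mult p m)
  have "\<not> p dvd m"
  proof
    assume "p dvd m"
    hence "p\<^sup>2 dvd p * m" by (simp add: power2_eq_square)
    thus False using mult squarefreeD[of "p * m" p] by auto
  qed
  hence "coprime (int p) (int m)" using mult by (simp add: prime_imp_coprime)
  moreover have "squarefree m" using mult(4) squarefree_mono dvd_triv_right by blast
  hence "QuadRes (int m) a" using mult by simp
  ultimately show ?case using QuadRes_mult_coprime mult by simp
qed (use QuadRes_1 in simp)

text \<open>Takes the place of the Jacobi symbol: reciprocity is applied to each prime factor of N,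
  and both sides are multiplicative in N.\<close>

lemma multiplicative_eqI:
  fixes f g :: "nat \<Rightarrow> int"
  assumes "n > 0" "f 1 = g 1" "\<And>m n. f (m * n) = f m * f n" "\<And>m n. g (m * n) = g m * g n"
    and "\<And>p. prime p \<Longrightarrow> p dvd n \<Longrightarrow> f p = g p"
  shows "f n = g n"
  using assms(1,5) by (induction n rule: nat_prime_factor_induct) (use assms(2-4) in auto)

lemma norm_form_represents_multiple_QuadRes:
  fixes N t :: nat
  assumes "N > 0" "t > 0" "coprime N t" "QuadRes (int N) (- int t)" "QuadRes (int t) (int N)"
  shows "\<exists>X Y Z. X \<noteq> 0 \<and> int N * X\<^sup>2 = Z\<^sup>2 + int t * Y\<^sup>2"
proof -
  obtain \<alpha> \<beta> where "int N dvd \<alpha>\<^sup>2 + int t" "int t dvd \<beta>\<^sup>2 - int N"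
    using assms(4,5) by (auto simp: QuadRes_def cong_iff_dvd_diff)
  thus ?thesis using norm_form_represents_multiple[of "int t" "int N" \<alpha> \<beta>] assms by auto
qed

lemma Legendre_nonzero_primes:
  assumes "prime p" "prime q" "p \<noteq> (q :: nat)"
  shows "Legendre (int p) (int q) = 1 \<or> Legendre (int p) (int q) = -1"
proof -
  have "\<not> q dvd p" using assms primes_dvd_imp_eq by blast
  thus ?thesis by (simp add: Legendre_def cong_0_iff)
qed

lemma Legendre_flip:
  assumes p: "prime p" "2 < p" and q: "prime q" "2 < q" and "p \<noteq> q"
  shows "q mod 4 = 1 \<Longrightarrow> Legendre (int p) (int q) = Legendre (int q) (int p)"
    and "q mod 4 = 3 \<Longrightarrow> Legendre (int p) (int q) = chi4 p * Legendre (int q) (int p)"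
proof -
  have "odd p" using p prime_odd_nat by blast
  have QR: "Legendre (int p) (int q) * Legendre (int q) (int p) = (-1) ^ ((p - 1) div 2 * ((q - 1) div 2))"
    using Quadratic_Reciprocity assms by blast
  have L: "Legendre (int q) (int p) = 1 \<or> Legendre (int q) (int p) = -1"
    using Legendre_nonzero_primes assms by blast
  show "Legendre (int p) (int q) = Legendre (int q) (int p)" if "q mod 4 = 1"
  proof -
    have "even ((q - 1) div 2)" using that by presburger
    thus ?thesis using QR L by auto
  qed
  show "Legendre (int p) (int q) = chi4 p * Legendre (int q) (int p)" if "q mod 4 = 3"
  proof -
    have "odd ((q - 1) div 2)" using that by presburger
    hence "(-1 :: int) ^ ((p - 1) div 2 * ((q - 1) div 2)) = chi4 p"
      unfolding chi4_eq_power[OF \<open>odd p\<close>] mult.commute[of "(p - 1) div 2"] power_mult by simp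
    thus ?thesis using QR L by auto
  qed
qed

text \<open>As 3 is 3 modulo 4, reciprocity brings in the sign \<open>chi4 p\<close>, which cancels
  the symbol of -1.\<close>

lemma Legendre_minus_three:
  assumes p: "prime p" "3 < p"
  shows "Legendre (-3) (int p) = Legendre (int p) 3"
proof -
  have "odd p" using p prime_odd_nat[of p] by simp
  hence "chi4 p = 1 \<or> chi4 p = -1" using odd_mod_4[of p] by (auto simp: chi4_def)
  have "Legendre (int p) (int 3) = chi4 p * Legendre (int 3) (int p)"
    using p by (intro Legendre_flip(2)) auto
  moreover have "Legendre (-1 * 3) (int p) = chi4 p * Legendre 3 (int p)"
    using p Legendre_minus_one[of p] by (subst Legendre_mult) auto
  ultimately show ?thesis by simp
qed

text \<open>The pigeonhole lemma with t = 1. A multiple by a nonzero square suffices, since the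
  descent later removes every denominator.\<close>

lemma prime_multiple_sum_two_squares:
  assumes "prime q" "q mod 4 = 1"
  obtains c u v :: int where "c \<noteq> 0" "int q * c\<^sup>2 = u\<^sup>2 + v\<^sup>2"
proof -
  have "q \<noteq> 2" using assms(2) by auto
  hence q: "2 < q" using assms(1) prime_ge_2_nat[of q] by simp
  have "Legendre (-1) (int q) = 1" using assms q by (simp add: Legendre_minus_one chi4_def)
  hence "QuadRes (int q) (- int 1)" using Legendre_eq_1D by simp
  then obtain X Y Z where "X \<noteq> 0" "int q * X\<^sup>2 = Z\<^sup>2 + int 1 * Y\<^sup>2"
    using norm_form_represents_multiple_QuadRes[of q 1] QuadRes_1 q by auto
  thus ?thesis using that by simp
qed

lemma prime_multiple_square_plus_three_squares:
  assumes "prime q" "q > 3" "Legendre (int q) 3 = 1"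
  obtains c u v :: int where "c \<noteq> 0" "int q * c\<^sup>2 = u\<^sup>2 + 3 * v\<^sup>2"
proof -
  have "QuadRes (int q) (- int 3)" using Legendre_minus_three[of q] assms Legendre_eq_1D by simp
  moreover have "QuadRes (int 3) (int q)" using assms Legendre_eq_1D by simp
  moreover have "coprime q 3" using primes_coprime[of q 3] assms by simp
  ultimately obtain X Y Z where "X \<noteq> 0" "int q * X\<^sup>2 = Z\<^sup>2 + int 3 * Y\<^sup>2"
    using norm_form_represents_multiple_QuadRes[of q 3] assms by auto
  thus ?thesis using that by simp
qed

lemma chi4_one: "chi4 (Suc 0) = 1" and chi8_one: "chi8 (Suc 0) = 1"
  by (simp_all add: chi4_def chi8_def)

lemma prime_divisors_odd:
  assumes "odd (N :: nat)" "prime p" "p dvd N"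
  shows "2 < p"
proof -
  have "p \<noteq> 2" using assms by auto
  thus ?thesis using prime_ge_2_nat[OF assms(2)] by simp
qed

lemma Legendre_minus_mult:
  assumes "prime p" "2 < p"
  shows "Legendre (- a) (int p) = chi4 p * Legendre a (int p)"
  using Legendre_mult[OF assms, of "-1" a] Legendre_minus_one[OF assms] by simp

section \<open>Numbers represented by the two ternary forms\<close>

text \<open>For N = 1 (mod 4) take t = q with (q/p) = (-1/p) at every prime p dividing N; for N = 3
  (mod 8) take t = 2q with (q/p) = (-2/p). Either way -t is a square modulo N. As q = 1 (mod 8),
  reciprocity has no sign, so (N/q) is \<open>chi4 N\<close> or \<open>chi4 N * chi8 N\<close>,
  which is 1 in the respective case. Both q and 2q have a square multiple that is a sum of two
  squares.\<close>

lemma sum_three_squares_squarefree: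
  fixes N :: nat
  assumes N: "squarefree N" and mod: "N mod 4 = 1 \<or> N mod 8 = 3"
  shows "\<exists>x y z. int N = qform 0 x y z"
proof -
  have odd: "odd N" using mod by presburger
  hence "N > 0" by (intro Nat.gr0I) auto
  define S where "S = {p. prime p \<and> p dvd N}"
  have S: "finite S" "\<And>p. p \<in> S \<Longrightarrow> prime p \<and> 2 < p"
    using \<open>N > 0\<close> prime_divisors_odd[OF odd] by (auto simp: S_def)
  have pm1: "chi4 p = 1 \<or> chi4 p = -1" "chi8 p = 1 \<or> chi8 p = -1" if "p \<in> S" for p
  proof -
    have "odd p" using S(2)[OF that] prime_odd_nat by blast
    thus "chi4 p = 1 \<or> chi4 p = -1" "chi8 p = 1 \<or> chi8 p = -1"
      using odd_mod_4[of p] odd_mod_8[of p] by (auto simp: chi4_def chi8_def)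
  qed
  obtain t :: nat and X Y Z c u v :: int
    where t: "X \<noteq> 0" "int N * X\<^sup>2 = Z\<^sup>2 + int t * Y\<^sup>2" "c \<noteq> 0" "int t * c\<^sup>2 = u\<^sup>2 + v\<^sup>2"
  proof (cases "N mod 4 = 1")
    case True
    obtain q where q: "prime q" "[q = 1] (mod 8)" "q \<notin> S" "\<And>p. p \<in> S \<Longrightarrow> Legendre (int q) (int p) = chi4 p"
      using exists_prime_with_Legendre_symbols[of S 1 chi4] S pm1(1) by auto
    have q8: "q mod 8 = 1" using q(2) by (simp add: cong_def)
    hence q4: "q mod 4 = 1" by presburger
    hence "q \<noteq> 2" by auto
    hence q2: "2 < q" using prime_ge_2_nat[OF q(1)] by simp
    have cop: "coprime N q" using coprime_primeI[OF q(1)] q(1,3) by (simp add: S_def)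
    have "Legendre (int N) (int q) = chi4 N"
    proof (rule multiplicative_eqI[OF \<open>N > 0\<close>])
      fix p assume "prime p" "p dvd N"
      hence p: "p \<in> S" by (simp add: S_def)
      hence "p \<noteq> q" using q(3) by blast
      thus "Legendre (int p) (int q) = chi4 p" using Legendre_flip(1)[of p q] S(2)[OF p] q p q2 q4 by simp
    qed (use q q2 in \<open>auto simp: Legendre_mult chi4_mult Legendre_one chi4_one\<close>)
    hence "QuadRes (int q) (int N)" using True Legendre_eq_1D by (simp add: chi4_def)
    moreover have "QuadRes (int N) (- int q)"
    proof (rule QuadRes_squarefree[OF \<open>N > 0\<close> N])
      fix p assume "prime p" "p dvd N"
      hence p: "p \<in> S" by (simp add: S_def)
      have "Legendre (- int q) (int p) = 1"
        using Legendre_minus_mult[of p "int q"] S(2)[OF p] q(4)[OF p] pm1(1)[OF p] by auto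
      thus "QuadRes (int p) (- int q)" by (rule Legendre_eq_1D)
    qed
    ultimately obtain X Y Z where "X \<noteq> 0" "int N * X\<^sup>2 = Z\<^sup>2 + int q * Y\<^sup>2"
      using norm_form_represents_multiple_QuadRes[of N q] cop q2 \<open>N > 0\<close> by auto
    moreover obtain c u v where "c \<noteq> 0" "int q * c\<^sup>2 = u\<^sup>2 + v\<^sup>2"
      using prime_multiple_sum_two_squares[OF q(1) q4] by blast
    ultimately show ?thesis using that by blast
  next
    case False
    hence N8: "N mod 8 = 3" using mod by simp
    have "chi4 p * chi8 p = 1 \<or> chi4 p * chi8 p = -1" if "p \<in> S" for p
      using pm1[OF that] by auto
    then obtain q where q: "prime q" "[q = 1] (mod 8)" "q \<notin> S"
        "\<And>p. p \<in> S \<Longrightarrow> Legendre (int q) (int p) = chi4 p * chi8 p"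
      using exists_prime_with_Legendre_symbols[of S 1 "\<lambda>p. chi4 p * chi8 p"] S by auto
    have q8: "q mod 8 = 1" using q(2) by (simp add: cong_def)
    hence q4: "q mod 4 = 1" by presburger
    hence "q \<noteq> 2" by auto
    hence q2: "2 < q" using prime_ge_2_nat[OF q(1)] by simp
    have "odd q" using q4 by presburger
    have "coprime N q" using coprime_primeI[OF q(1)] q(1,3) by (simp add: S_def)
    hence cop: "coprime N (2 * q)" using odd by simp
    have "Legendre (int N) (int q) = chi4 N * chi8 N"
    proof (rule multiplicative_eqI[OF \<open>N > 0\<close>])
      fix p assume "prime p" "p dvd N"
      hence p: "p \<in> S" by (simp add: S_def)
      hence "p \<noteq> q" using q(3) by blast
      thus "Legendre (int p) (int q) = chi4 p * chi8 p" using Legendre_flip(1)[of p q] S(2)[OF p] q p q2 q4 by simp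
    qed (use q q2 in \<open>auto simp: Legendre_mult chi4_mult chi8_mult Legendre_one chi4_one chi8_one\<close>)
    moreover have "N mod 4 = 3" using N8 by presburger
    ultimately have "QuadRes (int q) (int N)" using N8 Legendre_eq_1D by (simp add: chi4_def chi8_def)
    hence "QuadRes (int (2 * q)) (int N)"
      using QuadRes_mult_coprime[of 2 "int q" "int N"] QuadRes_2 \<open>odd q\<close> by simp
    moreover have "QuadRes (int N) (- int (2 * q))"
    proof (rule QuadRes_squarefree[OF \<open>N > 0\<close> N])
      fix p assume "prime p" "p dvd N"
      hence p: "p \<in> S" by (simp add: S_def)
      have "Legendre (- (2 * int q)) (int p) = chi4 p * (chi8 p * (chi4 p * chi8 p))"
        using Legendre_minus_mult[of p "2 * int q"] Legendre_mult[of p 2 "int q"] Legendre_two[of p] S(2)[OF p] q(4)[OF p] by simp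
      hence "Legendre (- int (2 * q)) (int p) = 1" using pm1[OF p] by auto
      thus "QuadRes (int p) (- int (2 * q))" by (rule Legendre_eq_1D)
    qed
    ultimately obtain X Y Z where "X \<noteq> 0" "int N * X\<^sup>2 = Z\<^sup>2 + int (2 * q) * Y\<^sup>2"
      using norm_form_represents_multiple_QuadRes[of N "2 * q"] cop q2 \<open>N > 0\<close> by auto
    moreover obtain c u v where cuv: "c \<noteq> 0" "int q * c\<^sup>2 = u\<^sup>2 + v\<^sup>2"
      using prime_multiple_sum_two_squares[OF q(1) q4] by blast
    hence "int (2 * q) * c\<^sup>2 = (u + v)\<^sup>2 + (u - v)\<^sup>2" by (simp add: power2_eq_square algebra_simps)
    ultimately show ?thesis using that cuv(1) by blast
  qed
  have "int N * (X * c)\<^sup>2 = (Z\<^sup>2 + int t * Y\<^sup>2) * c\<^sup>2" by (simp add: t(2)[symmetric] power_mult_distrib)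
  also have "\<dots> = Z\<^sup>2 * c\<^sup>2 + (int t * c\<^sup>2) * Y\<^sup>2" by (simp add: algebra_simps)
  also have "\<dots> = qform 0 (Z * c) (u * Y) (v * Y)"
    unfolding t(4) by (simp add: qform_def power_mult_distrib algebra_simps)
  finally have "int N * \<bar>X * c\<bar>\<^sup>2 = qform 0 (Z * c) (u * Y) (v * Y)" by simp
  thus ?thesis using qform_integral_of_rational[of 0 "\<bar>X * c\<bar>"] t by auto
qed

text \<open>Take t = q = 7 (mod 8) with (q/3) = 1 and (q/p) = (-1/p) for odd p dividing N. Then
  (-q/p) = 1, and since q = 3 (mod 4) reciprocity gives (p/q) = 1 as well; the class 7 also yields
  (2/q) = 1. If 3 divided N, the two demands on (q/3) would clash.\<close>

lemma qform_one_squarefree: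
  fixes N :: nat
  assumes N: "squarefree N" and "\<not> 3 dvd N"
  shows "\<exists>x y z. int N = qform 1 x y z"
proof -
  have "N > 0" using assms by (intro Nat.gr0I) auto
  define S where "S = {p. prime p \<and> 2 < p \<and> p dvd N}"
  define e where "e p = (if p = 3 then 1 else chi4 p)" for p
  have S: "finite S" "\<And>p. p \<in> S \<Longrightarrow> prime p \<and> 2 < p" "3 \<notin> S"
    using \<open>N > 0\<close> assms(2) by (auto simp: S_def)
  have pm1: "chi4 p = 1 \<or> chi4 p = -1" if "p \<in> S" for p
  proof -
    have "odd p" using S(2)[OF that] prime_odd_nat by blast
    thus "chi4 p = 1 \<or> chi4 p = -1" using odd_mod_4[of p] by (auto simp: chi4_def)
  qed
  have "\<exists>q. prime q \<and> [q = 7] (mod 8) \<and> q \<notin> insert 3 S \<and> (\<forall>p\<in>insert 3 S. Legendre (int q) (int p) = e p)"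
    by (rule exists_prime_with_Legendre_symbols) (use S pm1 in \<open>auto simp: e_def\<close>)
  then obtain q where q: "prime q" "[q = 7] (mod 8)" "q \<notin> insert 3 S"
      "\<And>p. p \<in> insert 3 S \<Longrightarrow> Legendre (int q) (int p) = e p" by blast
  have q3: "Legendre (int q) 3 = 1" using q(4)[of 3] by (simp add: e_def)
  have qS: "Legendre (int q) (int p) = chi4 p" if "p \<in> S" for p
  proof -
    have "p \<noteq> 3" using S(3) that by blast
    thus ?thesis using q(4)[of p] that by (simp add: e_def)
  qed
  have q8: "q mod 8 = 7" using q(2) by (simp add: cong_def)
  hence q4: "q mod 4 = 3" by presburger
  hence "q \<noteq> 2" "q \<noteq> 3" using q(3) by auto
  hence q2: "3 < q" using prime_ge_2_nat[OF q(1)] by simp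
  have cop: "coprime N q" using coprime_primeI[OF q(1)] q(1,3) q2 by (simp add: S_def)
  have "Legendre (int N) (int q) = 1"
  proof (rule multiplicative_eqI[OF \<open>N > 0\<close>])
    fix p assume p: "prime p" "p dvd N"
    show "Legendre (int p) (int q) = 1"
    proof (cases "p = 2")
      case True
      thus ?thesis using Legendre_two[OF q(1)] q2 q8 by (simp add: chi8_def)
    next
      case False
      hence "p \<in> S" using p prime_ge_2_nat[OF p(1)] by (simp add: S_def)
      moreover have "p \<noteq> q" using q(3) \<open>p \<in> S\<close> by blast
      ultimately show ?thesis
        using Legendre_flip(2)[of p q] S(2)[of p] q qS[of p] q2 q4 pm1[of p] by auto
    qed
  qed (use q q2 in \<open>auto simp: Legendre_mult Legendre_one\<close>)
  hence "QuadRes (int q) (int N)" using Legendre_eq_1D by simp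
  moreover have "QuadRes (int N) (- int q)"
  proof (rule QuadRes_squarefree[OF \<open>N > 0\<close> N])
    fix p assume p: "prime p" "p dvd N"
    show "QuadRes (int p) (- int q)"
    proof (cases "p = 2")
      case True
      thus ?thesis using QuadRes_2 by simp
    next
      case False
      hence "p \<in> S" using p prime_ge_2_nat[OF p(1)] by (simp add: S_def)
      hence "Legendre (- int q) (int p) = 1"
        using Legendre_minus_mult[of p "int q"] S(2)[of p] qS[of p] pm1[of p] by auto
      thus ?thesis by (rule Legendre_eq_1D)
    qed
  qed
  ultimately obtain X Y Z where t: "X \<noteq> 0" "int N * X\<^sup>2 = Z\<^sup>2 + int q * Y\<^sup>2"
    using norm_form_represents_multiple_QuadRes[of N q] cop q2 \<open>N > 0\<close> by auto
  obtain c u v where c: "c \<noteq> 0" "int q * c\<^sup>2 = u\<^sup>2 + 3 * v\<^sup>2"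
    using prime_multiple_square_plus_three_squares[OF q(1) q2 q3] by blast
  have "int N * (X * c)\<^sup>2 = (Z\<^sup>2 + int q * Y\<^sup>2) * c\<^sup>2" by (simp add: t(2)[symmetric] power_mult_distrib)
  also have "\<dots> = Z\<^sup>2 * c\<^sup>2 + (int q * c\<^sup>2) * Y\<^sup>2" by (simp add: algebra_simps)
  \<comment> \<open>Substituting (p - r, 2r) into y^2 + y z + z^2 gives p^2 + 3 r^2.\<close>
  also have "\<dots> = qform 1 (Z * c) (u * Y - v * Y) (2 * v * Y)"
    unfolding c(2) by (simp add: qform_def power2_eq_square algebra_simps)
  finally have "int N * \<bar>X * c\<bar>\<^sup>2 = qform 1 (Z * c) (u * Y - v * Y) (2 * v * Y)" by simp
  thus ?thesis using qform_integral_of_rational[of 1 "\<bar>X * c\<bar>"] t c by auto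
qed

text \<open>Take t = 3q with q = 1 (mod 8) and (q/p) = (p/3) = (-3/p), so that -3q is a square
  modulo N and (N/q) = (N/3) = 1. Tripling N X^2 = Z^2 + 3q Y^2 gives 3 Z^2 + 9q Y^2, so here q must
  be a sum of two squares up to a square factor, not a value of u^2 + 3 v^2.\<close>

lemma qform_one_triple_squarefree:
  fixes N :: nat
  assumes N: "squarefree N" and mod: "N mod 6 = 1"
  shows "\<exists>x y z. 3 * int N = qform 1 x y z"
proof -
  have odd: "odd N" and N3: "N mod 3 = 1" using mod by presburger+
  hence "N > 0" by (intro Nat.gr0I) auto
  define S where "S = {p. prime p \<and> p dvd N}"
  have "p \<noteq> 3" if "p \<in> S" for p using that N3 by (auto simp: S_def)
  hence S: "finite S" "\<And>p. p \<in> S \<Longrightarrow> prime p \<and> 2 < p \<and> 3 < p"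
    using \<open>N > 0\<close> prime_divisors_odd[OF odd] by (auto simp: S_def) (metis Suc_lessI numeral_2_eq_2 numeral_3_eq_3)
  have pm1: "Legendre (int p) 3 = 1 \<or> Legendre (int p) 3 = -1" if "p \<in> S" for p
    using Legendre_nonzero_primes[of p 3] S(2)[OF that] by simp
  have "\<exists>q. prime q \<and> [q = 1] (mod 8) \<and> q \<notin> S \<and> (\<forall>p\<in>S. Legendre (int q) (int p) = Legendre (int p) 3)"
    by (rule exists_prime_with_Legendre_symbols) (use S pm1 in auto)
  then obtain q where q: "prime q" "[q = 1] (mod 8)" "q \<notin> S"
      "\<And>p. p \<in> S \<Longrightarrow> Legendre (int q) (int p) = Legendre (int p) 3" by blast
  have q8: "q mod 8 = 1" using q(2) by (simp add: cong_def)
  hence q4: "q mod 4 = 1" by presburger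
  hence "q \<noteq> 2" "q \<noteq> 3" by auto
  hence q2: "3 < q" using prime_ge_2_nat[OF q(1)] by simp
  have q3: "coprime (3::nat) q" using primes_coprime[of 3 q] q(1) q2 by simp
  have "coprime N q" using coprime_primeI[OF q(1)] q(1,3) by (simp add: S_def)
  moreover have "coprime N 3" using N3 coprime_primeI[of 3 N] by (auto simp: dvd_eq_mod_eq_0)
  ultimately have cop: "coprime N (3 * q)" by simp
  have L3: "Legendre (int N) 3 = 1"
  proof -
    have "[int N = int 1] (mod int 3)" unfolding cong_int_iff using N3 by (simp add: cong_def)
    thus ?thesis using Legendre_cong Legendre_one[of 3] by simp
  qed
  have "Legendre (int N) (int q) = Legendre (int N) (int 3)"
  proof (rule multiplicative_eqI[OF \<open>N > 0\<close>])
    fix p assume "prime p" "p dvd N"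
    hence p: "p \<in> S" by (simp add: S_def)
    hence "p \<noteq> q" using q(3) by blast
    thus "Legendre (int p) (int q) = Legendre (int p) (int 3)"
      using Legendre_flip(1)[of p q] S(2)[OF p] q p q2 q4 by simp
  next
    fix m n :: nat
    show "Legendre (int (m * n)) (int q) = Legendre (int m) (int q) * Legendre (int n) (int q)"
      using q q2 by (simp add: Legendre_mult)
    show "Legendre (int (m * n)) (int 3) = Legendre (int m) (int 3) * Legendre (int n) (int 3)"
      unfolding of_nat_mult by (rule Legendre_mult) auto
  qed (use q2 in \<open>auto simp: Legendre_one\<close>)
  hence "QuadRes (int q) (int N)" "QuadRes 3 (int N)" using Legendre_eq_1D L3 by simp_all
  hence "QuadRes (int (3 * q)) (int N)"
    using QuadRes_mult_coprime[of 3 "int q" "int N"] q3 by (simp add: coprime_int_iff[symmetric])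
  moreover have "QuadRes (int N) (- int (3 * q))"
  proof (rule QuadRes_squarefree[OF \<open>N > 0\<close> N])
    fix p assume "prime p" "p dvd N"
    hence p: "p \<in> S" by (simp add: S_def)
    have "Legendre (- 3 * int q) (int p) = Legendre (int p) 3 * Legendre (int p) 3"
      using Legendre_mult[of p "-3" "int q"] Legendre_minus_three[of p] S(2)[OF p] q(4)[OF p] by simp
    hence "Legendre (- int (3 * q)) (int p) = 1" using pm1[OF p] by auto
    thus "QuadRes (int p) (- int (3 * q))" by (rule Legendre_eq_1D)
  qed
  ultimately obtain X Y Z where t: "X \<noteq> 0" "int N * X\<^sup>2 = Z\<^sup>2 + int (3 * q) * Y\<^sup>2"
    using norm_form_represents_multiple_QuadRes[of N "3 * q"] cop q2 \<open>N > 0\<close> by auto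
  obtain c u v where c: "c \<noteq> 0" "int q * c\<^sup>2 = u\<^sup>2 + v\<^sup>2"
    using prime_multiple_sum_two_squares[OF q(1) q4] by blast
  have "3 * int N * (X * c)\<^sup>2 = 3 * (int N * X\<^sup>2) * c\<^sup>2"
    by (simp only: power_mult_distrib mult_ac)
  also have "\<dots> = 3 * (Z\<^sup>2 + int (3 * q) * Y\<^sup>2) * c\<^sup>2" by (simp only: t(2))
  also have "\<dots> = 3 * Z\<^sup>2 * c\<^sup>2 + 9 * (int q * c\<^sup>2) * Y\<^sup>2" by (simp add: algebra_simps)
  also have "\<dots> = qform 1 (3 * u * Y) (3 * v * Y - Z * c) (2 * Z * c)"
    unfolding c(2) by (simp add: qform_def power2_eq_square algebra_simps)
  finally have "3 * int N * \<bar>X * c\<bar>\<^sup>2 = qform 1 (3 * u * Y) (3 * v * Y - Z * c) (2 * Z * c)" by simp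
  thus ?thesis using qform_integral_of_rational[of 1 "\<bar>X * c\<bar>"] t c by auto
qed

lemma qform_scale: fixes k :: int shows "qform e (k * x) (k * y) (k * z) = k\<^sup>2 * qform e x y z"
  by (simp add: qform_def power2_eq_square algebra_simps)

lemma odd_square_mod_8: "odd (k :: nat) \<Longrightarrow> k\<^sup>2 mod 8 = 1"
  using odd_mod_8[of k] by (auto simp: power2_eq_square mod_mult_eq[of k 8 k, symmetric])

theorem sum_three_squares:
  assumes "N mod 4 = 1 \<or> N mod 8 = 3"
  shows "\<exists>x y z. int N = qform 0 x y z"
proof -
  define m k where "m = squarefree_part N" "k = square_part N"
  have N: "N = m * k\<^sup>2" unfolding m_k_def by (rule squarefree_decompose)
  have "odd N" using assms by presburger
  hence "odd k" using N by auto
  hence "N mod 8 = m mod 8" using odd_square_mod_8[of k] unfolding N by (simp add: mod_mult_right_eq[of m _ 8, symmetric])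
  hence "m mod 4 = 1 \<or> m mod 8 = 3" using assms mod_4_of_mod_8[of N] mod_4_of_mod_8[of m] by simp
  then obtain x y z where "int m = qform 0 x y z"
    using sum_three_squares_squarefree[of m] by (auto simp: m_k_def)
  hence "int N = qform 0 (int k * x) (int k * y) (int k * z)" by (simp add: N qform_scale)
  thus ?thesis by blast
qed

theorem qform_one_represents:
  assumes "\<not> 3 dvd N"
  shows "\<exists>x y z. int N = qform 1 x y z"
proof -
  define m k where "m = squarefree_part N" "k = square_part N"
  have N: "N = m * k\<^sup>2" unfolding m_k_def by (rule squarefree_decompose)
  hence "\<not> 3 dvd m" using assms by auto
  then obtain x y z where "int m = qform 1 x y z"
    using qform_one_squarefree[of m] by (auto simp: m_k_def)
  hence "int N = qform 1 (int k * x) (int k * y) (int k * z)" by (simp add: N qform_scale)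
  thus ?thesis by blast
qed

theorem qform_one_represents_triple:
  assumes "N mod 6 = 1"
  shows "\<exists>x y z. 3 * int N = qform 1 x y z"
proof -
  define m k where "m = squarefree_part N" "k = square_part N"
  have N: "N = m * k\<^sup>2" unfolding m_k_def by (rule squarefree_decompose)
  have "odd N" "\<not> 3 dvd N" using assms by presburger+
  hence "odd k" "\<not> 3 dvd k" unfolding N by (auto simp: power2_eq_square)
  hence "k mod 6 \<in> {1, 5}" by simp presburger
  hence "k\<^sup>2 mod 6 = 1" by (auto simp: power2_eq_square mod_mult_eq[of k 6 k, symmetric])
  hence "m mod 6 = 1" using assms unfolding N by (simp add: mod_mult_right_eq[of m _ 6, symmetric])
  then obtain x y z where "3 * int m = qform 1 x y z"
    using qform_one_triple_squarefree[of m] by (auto simp: m_k_def)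
  hence "3 * int N = qform 1 (int k * x) (int k * y) (int k * z)" by (simp add: N qform_scale)
  thus ?thesis by blast
qed

section \<open>Sums of pentagonal numbers\<close>

definition unit_mod_6 :: "int \<Rightarrow> bool" where
  "unit_mod_6 u \<longleftrightarrow> odd u \<and> \<not> 3 dvd u"

lemma polygonal_5: "24 * polygonal 5 x + 1 = (6 * x - 1)\<^sup>2"
proof -
  define d where "d = x * (x - 1) div 2"
  have "2 * d = x * (x - 1)" by (simp add: d_def)
  thus ?thesis unfolding polygonal_def d_def[symmetric] by (simp add: power2_eq_square algebra_simps)
qed

lemma square_eq_pentagonal:
  assumes "unit_mod_6 u"
  shows "\<exists>x. u\<^sup>2 = 24 * polygonal 5 x + 1"
proof -
  have "u mod 6 = 1 \<or> u mod 6 = 5" using assms unfolding unit_mod_6_def by presburger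
  hence "\<exists>x. u = 6 * x - 1 \<or> u = - (6 * x - 1)" by presburger
  thus ?thesis unfolding polygonal_5 by (metis power2_minus)
qed

lemma pentagonal_sum_of_squares:
  assumes "24 * int n + 1 + b + c = u\<^sup>2 + b * v\<^sup>2 + c * w\<^sup>2" "unit_mod_6 u" "unit_mod_6 v" "unit_mod_6 w"
  shows "\<exists>x y z. int n = polygonal 5 x + b * polygonal 5 y + c * polygonal 5 z"
proof -
  obtain x y z where eq: "u\<^sup>2 = 24 * polygonal 5 x + 1" "v\<^sup>2 = 24 * polygonal 5 y + 1" "w\<^sup>2 = 24 * polygonal 5 z + 1"
    using assms(2-4) square_eq_pentagonal by metis
  have "24 * int n = 24 * (polygonal 5 x + b * polygonal 5 y + c * polygonal 5 z)"
    using assms(1) unfolding eq by (simp add: algebra_simps)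
  hence "int n = polygonal 5 x + b * polygonal 5 y + c * polygonal 5 z" by simp
  thus ?thesis by blast
qed

lemma odd_squareE:
  fixes x :: int
  assumes "odd x"
  obtains j where "x\<^sup>2 = 8 * j + 1"
proof -
  obtain m where m: "x = 2 * m + 1" using assms by (rule oddE)
  obtain l where "m * (m + 1) = 2 * l" using evenE[of "m * (m + 1)"] by auto
  hence "x\<^sup>2 = 8 * l + 1" by (simp add: m power2_eq_square algebra_simps)
  thus ?thesis by (rule that)
qed

lemma even_squareE:
  fixes x :: int
  assumes "even x"
  obtains j where "x\<^sup>2 = 4 * j"
proof -
  obtain m where m: "x = 2 * m" using assms by (rule evenE)
  have "x\<^sup>2 = 4 * m\<^sup>2" by (simp add: m power2_eq_square)
  thus ?thesis by (rule that)
qed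

lemma square_dvd_3E:
  fixes x :: int
  assumes "3 dvd x"
  obtains j where "x\<^sup>2 = 3 * j"
proof -
  obtain m where "x = 3 * m" using assms by (rule dvdE)
  hence "x\<^sup>2 = 3 * (m * x)" by (simp add: power2_eq_square)
  thus ?thesis by (rule that)
qed

lemma square_not_dvd_3E:
  fixes x :: int
  assumes "\<not> 3 dvd x"
  obtains j where "x\<^sup>2 = 3 * j + 1"
proof -
  have "\<exists>m. x = 3 * m + 1 \<or> x = 3 * m - 1" using assms by presburger
  then consider m where "x = 3 * m + 1" | m where "x = 3 * m - 1" by blast
  thus ?thesis
  proof cases
    case 1
    hence "x\<^sup>2 = 3 * (m * (3 * m + 2)) + 1" by (simp add: power2_eq_square algebra_simps)
    thus ?thesis by (rule that)
  next
    case 2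
    have "x\<^sup>2 = 3 * (m * (3 * m - 2)) + 1" unfolding 2 by (simp add: power2_eq_square algebra_simps)
    thus ?thesis by (rule that)
  qed
qed

lemma mod_eqI: "a = m * k + r \<Longrightarrow> 0 \<le> r \<Longrightarrow> r < m \<Longrightarrow> a mod m = (r :: int)"
  by simp

lemma even_if_mod_8_eq_4: "a mod 8 = 4 \<Longrightarrow> even (a :: int)"
  by presburger

lemma odd_square_plus_three_odd_squares:
  fixes x y :: int
  assumes "odd x" "odd y"
  shows "(x\<^sup>2 + 3 * y\<^sup>2) mod 8 = 4"
proof -
  obtain i j where "x\<^sup>2 = 8 * i + 1" "y\<^sup>2 = 8 * j + 1" using assms odd_squareE by metis
  thus ?thesis by (intro mod_eqI[of _ _ "i + 3 * j"]) simp_all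
qed

lemma sum_three_squares_mod_8_eq_3:
  fixes x y z :: int
  assumes "x\<^sup>2 + y\<^sup>2 + z\<^sup>2 = 8 * i + 3"
  shows "odd x \<and> odd y \<and> odd z"
proof -
  have *: "odd x" if eq: "x\<^sup>2 + y\<^sup>2 + z\<^sup>2 = 8 * i + 3" for x y z :: int
  proof
    assume "even x"
    then obtain p where p: "x\<^sup>2 = 4 * p" by (rule even_squareE)
    obtain q r where q: "y\<^sup>2 = 4 * q \<or> y\<^sup>2 = 8 * q + 1" and r: "z\<^sup>2 = 4 * r \<or> z\<^sup>2 = 8 * r + 1"
      using even_squareE odd_squareE by metis
    have "4 * p + y' + z' = 8 * i + 3 \<Longrightarrow> y' = 4 * q \<or> y' = 8 * q + 1 \<Longrightarrow>
        z' = 4 * r \<or> z' = 8 * r + 1 \<Longrightarrow> False" for y' z' :: int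
      by presburger
    thus False using eq q r unfolding p by blast
  qed
  show ?thesis using *[of x y z] *[of y x z] *[of z x y] assms by (simp add: add_ac)
qed

text \<open>
  \<open>y\<^sup>2 + 3 z\<^sup>2\<close> is four times the norm form of the Eisenstein integers when \<open>y \<equiv> z (mod 2)\<close>;
  both adjustments below multiply by a sixth root of unity.
\<close>
lemma square_plus_three_squares_units:
  fixes y z :: int
  assumes m8: "(y\<^sup>2 + 3 * z\<^sup>2) mod 8 = 4" and y3: "\<not> 3 dvd y"
  shows "\<exists>y' z'. unit_mod_6 y' \<and> unit_mod_6 z' \<and> y'\<^sup>2 + 3 * z'\<^sup>2 = y\<^sup>2 + 3 * z\<^sup>2"
proof -
  have "\<exists>p q. odd p \<and> odd q \<and> p\<^sup>2 + 3 * q\<^sup>2 = y\<^sup>2 + 3 * z\<^sup>2"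
  proof (cases "odd y")
    case True
    hence "odd z" using even_if_mod_8_eq_4[OF m8] by simp
    thus ?thesis using True by blast
  next
    case False
    hence "even z" using even_if_mod_8_eq_4[OF m8] by simp
    then obtain a b where ab: "y = 2 * a" "z = 2 * b" using False by blast
    define d where "d = a\<^sup>2 + 3 * b\<^sup>2"
    have "y\<^sup>2 + 3 * z\<^sup>2 = 4 * d" by (simp add: d_def ab power2_eq_square)
    hence "(4 * d) mod 8 = 4" using m8 by simp
    hence "odd d" by presburger
    hence "odd (a + 3 * b)" "odd (a - b)" by (auto simp: d_def)
    \<comment> \<open>These are, up to sign, the coordinates of (a + b sqrt(-3)) (1 - sqrt(-3)). As
      d is odd, a and b have opposite parity.\<close>
    moreover have "(a + 3 * b)\<^sup>2 + 3 * (a - b)\<^sup>2 = y\<^sup>2 + 3 * z\<^sup>2"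
      by (simp add: ab power2_eq_square algebra_simps)
    ultimately show ?thesis by blast
  qed
  then obtain p q where pq: "odd p" "odd q" "p\<^sup>2 + 3 * q\<^sup>2 = y\<^sup>2 + 3 * z\<^sup>2" by blast
  have p3: "\<not> 3 dvd p"
  proof
    assume "3 dvd p"
    hence "3 dvd p\<^sup>2 + 3 * q\<^sup>2" by (simp add: power2_eq_square)
    hence "3 dvd (y\<^sup>2 + 3 * z\<^sup>2) - 3 * z\<^sup>2" unfolding pq(3) by (rule dvd_diff) simp
    hence "3 dvd y\<^sup>2" by simp
    thus False using y3 prime_dvd_power[of "3::int" y 2] by simp
  qed
  show ?thesis
  proof (cases "3 dvd q")
    case False
    thus ?thesis using pq p3 unfolding unit_mod_6_def by blast
  next
    case True
    \<comment> \<open>(p + q)/2 and (p - q)/2 differ by the odd number q, so exactly one of them is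
      odd. Divisibility of r by 3 then carries the nondivisibility of p over to both new coordinates
      (p + r)/2 and (p - 3r)/2.\<close>
    have "\<exists>r. (r = q \<or> r = - q) \<and> odd ((p + r) div 2) \<and> even (p + r)" using pq(1,2) by presburger
    then obtain r where r: "r = q \<or> r = - q" "odd ((p + r) div 2)" "even (p + r)" by blast
    define h where "h = (p + r) div 2"
    have p: "p = 2 * h - r" using r(3) by (simp add: h_def)
    have r3: "3 dvd r" "odd r" using r(1) True pq(2) by auto
    have "odd h" using r(2) by (simp add: h_def)
    moreover have "\<not> 3 dvd h" using p p3 r3(1) by presburger
    moreover have "odd (h - 2 * r)" using \<open>odd h\<close> by simp
    moreover have "\<not> 3 dvd (h - 2 * r)" using \<open>\<not> 3 dvd h\<close> r3(1) by presburger
    moreover have "(h - 2 * r)\<^sup>2 + 3 * h\<^sup>2 = p\<^sup>2 + 3 * r\<^sup>2" by (simp add: p power2_eq_square algebra_simps)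
    moreover have "r\<^sup>2 = q\<^sup>2" using r(1) by auto
    ultimately show ?thesis using pq(3) unfolding unit_mod_6_def by metis
  qed
qed

text \<open>One of y, z and y + z is even, and each case permits completing the square over the
  integers.\<close>

lemma qform_one_eq_square_plus_three_squares:
  "\<exists>y' z'. qform 1 x y z = x\<^sup>2 + y'\<^sup>2 + 3 * z'\<^sup>2"
proof -
  have "even z \<or> even y \<or> even (y + z)" by auto
  then consider a where "z = 2 * a" | a where "y = 2 * a" | a where "y + z = 2 * a"
    unfolding dvd_def by blast
  thus ?thesis
  proof cases
    case 1
    have "qform 1 x y z = x\<^sup>2 + (y + a)\<^sup>2 + 3 * a\<^sup>2"
      by (simp add: 1 qform_def power2_eq_square algebra_simps)
    thus ?thesis by blast
  next
    case 2
    have "qform 1 x y z = x\<^sup>2 + (z + a)\<^sup>2 + 3 * a\<^sup>2"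
      by (simp add: 2 qform_def power2_eq_square algebra_simps)
    thus ?thesis by blast
  next
    case 3
    hence z: "z = 2 * a - y" by simp
    have "qform 1 x y z = x\<^sup>2 + (y - a)\<^sup>2 + 3 * a\<^sup>2"
      by (simp add: z qform_def power2_eq_square algebra_simps)
    thus ?thesis by blast
  qed
qed

text \<open>With x and y even, 3 z^2 would be 1 modulo 4, but it is 0 or 3.\<close>

lemma odd_or_odd_if_mod_8:
  fixes x y z :: int
  assumes "x\<^sup>2 + y\<^sup>2 + 3 * z\<^sup>2 = 8 * i + 5"
  shows "odd x \<or> odd y"
proof (rule ccontr)
  assume "\<not> ?thesis"
  hence "even x" "even y" by auto
  then obtain p q where pq: "x\<^sup>2 = 4 * p" "y\<^sup>2 = 4 * q" using even_squareE by metis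
  obtain r where r: "z\<^sup>2 = 4 * r \<or> z\<^sup>2 = 8 * r + 1" using even_squareE odd_squareE by metis
  show False
    using r
  proof
    assume "z\<^sup>2 = 4 * r"
    hence "5 = 4 * (p + q + 3 * r - 2 * i)" using assms pq by simp
    hence "(4 :: int) dvd 5" by (rule dvdI)
    thus False by simp
  next
    assume "z\<^sup>2 = 8 * r + 1"
    hence "2 = 4 * (p + q + 6 * r - 2 * i)" using assms pq by simp
    hence "(4 :: int) dvd 2" by (rule dvdI)
    thus False by simp
  qed
qed

lemma sum_two_squares_mod_3:
  fixes x y :: int
  shows "x\<^sup>2 + y\<^sup>2 = 3 * i \<Longrightarrow> 3 dvd x \<and> 3 dvd y"
    and "x\<^sup>2 + y\<^sup>2 = 3 * i + 1 \<Longrightarrow> 3 dvd x \<or> 3 dvd y"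
    and "x\<^sup>2 + y\<^sup>2 = 3 * i + 2 \<Longrightarrow> \<not> 3 dvd x \<and> \<not> 3 dvd y"
proof -
  obtain p q where p: "3 dvd x \<and> x\<^sup>2 = 3 * p \<or> \<not> 3 dvd x \<and> x\<^sup>2 = 3 * p + 1"
    and q: "3 dvd y \<and> y\<^sup>2 = 3 * q \<or> \<not> 3 dvd y \<and> y\<^sup>2 = 3 * q + 1"
    using square_dvd_3E square_not_dvd_3E by metis
  have lin: "x' = 3 * p \<or> x' = 3 * p + 1 \<Longrightarrow> y' = 3 * q \<or> y' = 3 * q + 1 \<Longrightarrow>
      (x' + y' = 3 * i \<longrightarrow> x' = 3 * p \<and> y' = 3 * q) \<and>
      (x' + y' = 3 * i + 1 \<longrightarrow> x' = 3 * p \<or> y' = 3 * q) \<and>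
      (x' + y' = 3 * i + 2 \<longrightarrow> x' = 3 * p + 1 \<and> y' = 3 * q + 1)" for x' y' :: int
    by presburger
  have dist: "3 * p \<noteq> 3 * p + 1" "3 * q \<noteq> 3 * q + 1" by simp_all
  show "x\<^sup>2 + y\<^sup>2 = 3 * i \<Longrightarrow> 3 dvd x \<and> 3 dvd y"
    and "x\<^sup>2 + y\<^sup>2 = 3 * i + 1 \<Longrightarrow> 3 dvd x \<or> 3 dvd y"
    and "x\<^sup>2 + y\<^sup>2 = 3 * i + 2 \<Longrightarrow> \<not> 3 dvd x \<and> \<not> 3 dvd y"
    using lin[of "x\<^sup>2" "y\<^sup>2"] p q dist by metis+
qed

section \<open>The six forms with all variables prime to 6\<close>

text \<open>Modulo 3 neither x nor y is divisible by 3, and one of them is odd. That one is kept,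
  and the other is adjusted together with z.\<close>

lemma unit_mod_6_form_1_1_3:
  assumes "24 * int n + 5 = x\<^sup>2 + y\<^sup>2 + 3 * z\<^sup>2"
  shows "\<exists>u v w. 24 * int n + 5 = u\<^sup>2 + v\<^sup>2 + 3 * w\<^sup>2 \<and> unit_mod_6 u \<and> unit_mod_6 v \<and> unit_mod_6 w"
proof -
  have *: ?thesis if eq: "24 * int n + 5 = x\<^sup>2 + y\<^sup>2 + 3 * z\<^sup>2" and "odd x" for x y z :: int
  proof -
    have "x\<^sup>2 + y\<^sup>2 = 3 * (8 * int n + 1 - z\<^sup>2) + 2" using eq by simp
    hence "\<not> 3 dvd x" "\<not> 3 dvd y" using sum_two_squares_mod_3(3) by blast+
    moreover obtain j where "x\<^sup>2 = 8 * j + 1" using odd_squareE[OF \<open>odd x\<close>] .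
    hence "(y\<^sup>2 + 3 * z\<^sup>2) mod 8 = 4" using eq by (intro mod_eqI[of _ _ "3 * int n - j"]) simp_all
    ultimately obtain v w where "unit_mod_6 v" "unit_mod_6 w" "v\<^sup>2 + 3 * w\<^sup>2 = y\<^sup>2 + 3 * z\<^sup>2"
      using square_plus_three_squares_units by blast
    moreover have "unit_mod_6 x" using \<open>odd x\<close> \<open>\<not> 3 dvd x\<close> by (simp add: unit_mod_6_def)
    ultimately show ?thesis using eq by (metis add.assoc)
  qed
  have "x\<^sup>2 + y\<^sup>2 + 3 * z\<^sup>2 = 8 * (3 * int n) + 5" using assms by simp
  hence "odd x \<or> odd y" by (rule odd_or_odd_if_mod_8)
  moreover have "24 * int n + 5 = y\<^sup>2 + x\<^sup>2 + 3 * z\<^sup>2" using assms by simp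
  ultimately show ?thesis using *[OF assms] * by blast
qed

text \<open>Modulo 3 one of x and y is a multiple 3k, leaving x^2 + 3 z^2 + 9 k^2. Units act first
  on x^2 + 3 z^2 and then, with the new v, on 3 (v^2 + 3 k^2). This needs k odd; an even k is first
  made odd by a unit acting on z^2 + 3 k^2.\<close>

lemma unit_mod_6_form_1_3_9:
  assumes "24 * int n + 13 = x\<^sup>2 + y\<^sup>2 + 3 * z\<^sup>2"
  shows "\<exists>u v w. 24 * int n + 13 = u\<^sup>2 + 3 * v\<^sup>2 + 9 * w\<^sup>2 \<and> unit_mod_6 u \<and> unit_mod_6 v \<and> unit_mod_6 w"
proof -
  have finish: ?thesis if eq: "24 * int n + 13 = x\<^sup>2 + 3 * z\<^sup>2 + 9 * y\<^sup>2"
    and x: "\<not> 3 dvd x" "(x\<^sup>2 + 3 * z\<^sup>2) mod 8 = 4" and "odd y" for x y z :: int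
  proof -
    obtain u v where uv: "unit_mod_6 u" "unit_mod_6 v" "u\<^sup>2 + 3 * v\<^sup>2 = x\<^sup>2 + 3 * z\<^sup>2"
      using square_plus_three_squares_units[OF x(2,1)] by blast
    have "odd v" "\<not> 3 dvd v" using uv(2) by (auto simp: unit_mod_6_def)
    moreover have "(v\<^sup>2 + 3 * y\<^sup>2) mod 8 = 4"
      using odd_square_plus_three_odd_squares \<open>odd v\<close> \<open>odd y\<close> by blast
    ultimately obtain v' w where vw: "unit_mod_6 v'" "unit_mod_6 w" "v'\<^sup>2 + 3 * w\<^sup>2 = v\<^sup>2 + 3 * y\<^sup>2"
      using square_plus_three_squares_units by blast
    have "24 * int n + 13 = u\<^sup>2 + 3 * v'\<^sup>2 + 9 * w\<^sup>2" using eq uv(3) vw(3) by linarith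
    thus ?thesis using uv vw by blast
  qed
  have *: ?thesis if eq: "24 * int n + 13 = x\<^sup>2 + y\<^sup>2 + 3 * z\<^sup>2" and "3 dvd y" for x y z :: int
  proof -
    obtain k where y: "y = 3 * k" using \<open>3 dvd y\<close> by blast
    have eq': "24 * int n + 13 = x\<^sup>2 + 3 * z\<^sup>2 + 9 * k\<^sup>2" using eq by (simp add: y power2_eq_square)
    have x3: "\<not> 3 dvd x"
    proof
      assume "3 dvd x"
      hence "3 dvd x\<^sup>2 + 3 * z\<^sup>2 + 9 * k\<^sup>2" by (auto intro!: dvd_add simp: power2_eq_square)
      hence "3 dvd 24 * int n + 13" by (simp only: eq')
      thus False by presburger
    qed
    show ?thesis
    proof (cases "odd k")
      case True
      obtain j where "k\<^sup>2 = 8 * j + 1" using odd_squareE[OF True] .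
      hence "(x\<^sup>2 + 3 * z\<^sup>2) mod 8 = 4" using eq' by (intro mod_eqI[of _ _ "3 * int n - 9 * j"]) simp_all
      thus ?thesis using finish[OF eq' x3] True by blast
    next
      case False
      hence "even y" by (simp add: y)
      moreover have "x\<^sup>2 + y\<^sup>2 + 3 * z\<^sup>2 = 8 * (3 * int n + 1) + 5" using eq by simp
      ultimately have "odd x" using odd_or_odd_if_mod_8 by blast
      obtain j where "x\<^sup>2 = 8 * j + 1" using odd_squareE[OF \<open>odd x\<close>] .
      \<comment> \<open>As 3 is its own inverse modulo 8, the value W is recovered from 3 W as 3 (3
        W) - 8 W.\<close>
      hence zk: "(z\<^sup>2 + 3 * k\<^sup>2) mod 8 = 4"
        using eq' by (intro mod_eqI[of _ _ "9 * int n + 4 - 3 * j - (z\<^sup>2 + 3 * k\<^sup>2)"]) simp_all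
      hence "even z" using even_if_mod_8_eq_4[OF zk] False by simp
      obtain a b where ab: "z = 2 * a" "k = 2 * b" using False \<open>even z\<close> by blast
      define d where "d = a\<^sup>2 + 3 * b\<^sup>2"
      have "z\<^sup>2 + 3 * k\<^sup>2 = 4 * d" by (simp add: d_def ab power2_eq_square)
      hence "(4 * d) mod 8 = 4" using zk by simp
      hence "odd d" by presburger
      hence odd: "odd (a + 3 * b)" "odd (a - b)" by (auto simp: d_def)
      have "(a + 3 * b)\<^sup>2 + 3 * (a - b)\<^sup>2 = z\<^sup>2 + 3 * k\<^sup>2"
        by (simp add: ab power2_eq_square algebra_simps)
      hence eq'': "24 * int n + 13 = x\<^sup>2 + 3 * (a + 3 * b)\<^sup>2 + 9 * (a - b)\<^sup>2" using eq' by linarith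
      have "(x\<^sup>2 + 3 * (a + 3 * b)\<^sup>2) mod 8 = 4"
        using odd_square_plus_three_odd_squares[OF \<open>odd x\<close> odd(1)] .
      thus ?thesis using finish[OF eq'' x3] odd(2) by blast
    qed
  qed
  have "x\<^sup>2 + y\<^sup>2 = 3 * (8 * int n + 4 - z\<^sup>2) + 1" using assms by simp
  hence "3 dvd x \<or> 3 dvd y" by (rule sum_two_squares_mod_3(2))
  moreover have "24 * int n + 13 = y\<^sup>2 + x\<^sup>2 + 3 * z\<^sup>2" using assms by simp
  ultimately show ?thesis using *[OF assms] * by blast
qed

text \<open>Modulo 3 both x and y are multiples of 3, so dividing the equation by 3 moves the
  coefficient 3 onto two squares, one of them odd. Units act on the unweighted square with each of
  the weighted ones in turn, the odd one last.\<close>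

lemma unit_mod_6_form_1_3_3:
  assumes "3 * (24 * int n + 7) = x\<^sup>2 + y\<^sup>2 + 3 * z\<^sup>2"
  shows "\<exists>u v w. 24 * int n + 7 = u\<^sup>2 + 3 * v\<^sup>2 + 3 * w\<^sup>2 \<and> unit_mod_6 u \<and> unit_mod_6 v \<and> unit_mod_6 w"
proof -
  have *: ?thesis if eq: "24 * int n + 7 = z\<^sup>2 + 3 * x\<^sup>2 + 3 * y\<^sup>2" and "odd y" for x y z :: int
  proof -
    have "\<not> 3 dvd z"
    proof
      assume "3 dvd z"
      hence "3 dvd z\<^sup>2 + 3 * x\<^sup>2 + 3 * y\<^sup>2" by (auto intro!: dvd_add simp: power2_eq_square)
      hence "3 dvd 24 * int n + 7" by (simp only: eq)
      thus False by presburger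
    qed
    moreover obtain j where "y\<^sup>2 = 8 * j + 1" using odd_squareE[OF \<open>odd y\<close>] .
    hence "(z\<^sup>2 + 3 * x\<^sup>2) mod 8 = 4" using eq by (intro mod_eqI[of _ _ "3 * int n - 3 * j"]) simp_all
    ultimately obtain u v where uv: "unit_mod_6 u" "unit_mod_6 v" "u\<^sup>2 + 3 * v\<^sup>2 = z\<^sup>2 + 3 * x\<^sup>2"
      using square_plus_three_squares_units by blast
    have "odd u" "\<not> 3 dvd u" using uv(1) by (auto simp: unit_mod_6_def)
    moreover have "(u\<^sup>2 + 3 * y\<^sup>2) mod 8 = 4"
      using odd_square_plus_three_odd_squares \<open>odd u\<close> \<open>odd y\<close> by blast
    ultimately obtain u' w where uw: "unit_mod_6 u'" "unit_mod_6 w" "u'\<^sup>2 + 3 * w\<^sup>2 = u\<^sup>2 + 3 * y\<^sup>2"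
      using square_plus_three_squares_units by blast
    have "24 * int n + 7 = u'\<^sup>2 + 3 * v\<^sup>2 + 3 * w\<^sup>2" using eq uv(3) uw(3) by linarith
    thus ?thesis using uv uw by blast
  qed
  have "x\<^sup>2 + y\<^sup>2 = 3 * (24 * int n + 7 - z\<^sup>2)" using assms by simp
  hence "3 dvd x" "3 dvd y" using sum_two_squares_mod_3(1) by blast+
  then obtain a b where ab: "x = 3 * a" "y = 3 * b" by blast
  have eq: "24 * int n + 7 = z\<^sup>2 + 3 * a\<^sup>2 + 3 * b\<^sup>2" using assms by (simp add: ab power2_eq_square)
  have "x\<^sup>2 + y\<^sup>2 + 3 * z\<^sup>2 = 8 * (9 * int n + 2) + 5" using assms by simp
  hence "odd x \<or> odd y" by (rule odd_or_odd_if_mod_8)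
  hence "odd a \<or> odd b" by (simp add: ab)
  moreover have "24 * int n + 7 = z\<^sup>2 + 3 * b\<^sup>2 + 3 * a\<^sup>2" using eq by simp
  ultimately show ?thesis using *[OF eq] * by blast
qed

text \<open>
  If \<open>w\<close> has norm \<open>2\<close>, then \<open>v \<mapsto> v - \<beta> w\<close> with \<open>2 \<beta> = B(v, w)\<close> is the reflection in \<open>w\<close>, and
  \<open>v \<mapsto> 2 v - B(v, w) w\<close> is twice it; the vectors used are \<open>(1, 1, 0)\<close>, \<open>(1, 0, 1)\<close>, \<open>(1, 1, -1)\<close>.
\<close>
lemma qform_one_odd_coordinate:
  assumes "K > 0" "K = qform 1 z s t"
  shows "\<exists>z s t. K = qform 1 z s t \<and> (odd s \<or> odd t)"
  using assms
proof (induction "nat K" arbitrary: K z s t rule: less_induct)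
  case less
  note K = \<open>K = qform 1 z s t\<close>
  show ?case
  proof (cases "odd s \<or> odd t")
    case True
    thus ?thesis using K by blast
  next
    case False
    then obtain a b where ab: "s = 2 * a" "t = 2 * b" by blast
    show ?thesis
    proof (cases "odd z")
      case True
      \<comment> \<open>Each alternative makes the reflection coefficient \<beta> odd for one of the
        three vectors, and subtracting \<beta> turns an even coordinate odd.\<close>
      have "even b \<or> even a \<or> even (a - b)" by auto
      then consider "even b" | "even a" | "even (a - b)" by blast
      thus ?thesis
      proof cases
        case 1
        define \<beta> where "\<beta> = z + 2 * a + b"
        have "K = qform 1 (z - \<beta>) (2 * a - \<beta>) (2 * b)"
          by (simp add: K ab \<beta>_def qform_def power2_eq_square algebra_simps)
        moreover have "odd (2 * a - \<beta>)" using 1 True by (simp add: \<beta>_def)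
        ultimately show ?thesis by blast
      next
        case 2
        define \<beta> where "\<beta> = z + a + 2 * b"
        have "K = qform 1 (z - \<beta>) (2 * a) (2 * b - \<beta>)"
          by (simp add: K ab \<beta>_def qform_def power2_eq_square algebra_simps)
        moreover have "odd (2 * b - \<beta>)" using 2 True by (simp add: \<beta>_def)
        ultimately show ?thesis by blast
      next
        case 3
        define \<beta> where "\<beta> = z + a - b"
        have "K = qform 1 (z - \<beta>) (2 * a - \<beta>) (2 * b + \<beta>)"
          by (simp add: K ab \<beta>_def qform_def power2_eq_square algebra_simps)
        moreover have "odd (2 * a - \<beta>)" using 3 True unfolding \<beta>_def by presburger
        ultimately show ?thesis by blast
      qed
    next
      case False
      then obtain c where c: "z = 2 * c" by blast
      define K1 where "K1 = qform 1 c a b"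
      have K4: "K = 4 * K1" by (simp add: K K1_def ab c qform_def power2_eq_square algebra_simps)
      hence "nat K1 < nat K" "K1 > 0" using less.prems(1) by auto
      from less.hyps[OF this K1_def] obtain z' s' t' where
        st: "K1 = qform 1 z' s' t'" "odd s' \<or> odd t'" by blast
      show ?thesis
      proof (cases "odd t'")
        case True
        define B where "B = 2 * z' + 2 * s' + t'"
        have "K = qform 1 (2 * z' - B) (2 * s' - B) (2 * t')"
          unfolding K4 st(1) by (simp add: B_def qform_def power2_eq_square algebra_simps)
        moreover have "odd (2 * s' - B)" using True by (simp add: B_def)
        ultimately show ?thesis by blast
      next
        case False
        define B where "B = 2 * z' + s' + 2 * t'"
        have "K = qform 1 (2 * z' - B) (2 * s') (2 * t' - B)"
          unfolding K4 st(1) by (simp add: B_def qform_def power2_eq_square algebra_simps)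
        moreover have "odd (2 * t' - B)" using False st(2) by (simp add: B_def)
        ultimately show ?thesis by blast
      qed
    qed
  qed
qed

text \<open>Multiplying by 4 turns m = s^2 + s t + t^2 into (2s + t)^2 + 3 t^2. Units can act on it
  only if 4m = 4 (mod 8), that is, m is odd, which is why an odd coordinate among s and t is needed;
  then w is odd too.\<close>

lemma unit_mod_6_form_1_3_4:
  assumes "6 * int n + 2 = qform 1 x y z"
  shows "\<exists>u v w. 24 * int n + 8 = u\<^sup>2 + 3 * v\<^sup>2 + 4 * w\<^sup>2 \<and> unit_mod_6 u \<and> unit_mod_6 v \<and> unit_mod_6 w"
proof -
  have "6 * int n + 2 > 0" by simp
  from qform_one_odd_coordinate[OF this assms] obtain w s t where
    st: "6 * int n + 2 = qform 1 w s t" "odd s \<or> odd t" by blast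
  define m where "m = s\<^sup>2 + s * t + t\<^sup>2"
  have m: "6 * int n + 2 = w\<^sup>2 + m" using st(1) by (simp add: m_def qform_def)
  have "odd m" using st(2) by (auto simp: m_def)
  moreover have "even (w\<^sup>2 + m)" unfolding m[symmetric] by simp
  ultimately have "odd w" by simp
  have eq: "(2 * s + t)\<^sup>2 + 3 * t\<^sup>2 = 4 * m" by (simp add: m_def power2_eq_square algebra_simps)
  have "((2 * s + t)\<^sup>2 + 3 * t\<^sup>2) mod 8 = 4" unfolding eq using \<open>odd m\<close> by presburger
  moreover have "w\<^sup>2 + (2 * s + t)\<^sup>2 = 3 * (8 * int n + 2 - t\<^sup>2 - w\<^sup>2) + 2"
    using eq m by simp
  hence "\<not> 3 dvd w" "\<not> 3 dvd (2 * s + t)" using sum_two_squares_mod_3(3) by blast+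
  ultimately obtain u v where "unit_mod_6 u" "unit_mod_6 v" "u\<^sup>2 + 3 * v\<^sup>2 = 4 * m"
    using square_plus_three_squares_units eq by metis
  moreover have "unit_mod_6 w" using \<open>odd w\<close> \<open>\<not> 3 dvd w\<close> by (simp add: unit_mod_6_def)
  moreover have "24 * int n + 8 = 4 * m + 4 * w\<^sup>2" using m by simp
  ultimately show ?thesis by metis
qed

text \<open>Division by \<open>9\<close> is undone by three times the reflection in \<open>(1, 1, 1)\<close>.\<close>
lemma sum_three_squares_not_dvd_3:
  fixes m :: int
  assumes "m > 0" "m = a\<^sup>2 + b\<^sup>2 + c\<^sup>2"
  shows "\<exists>a b c. m = a\<^sup>2 + b\<^sup>2 + c\<^sup>2 \<and> \<not> 3 dvd c \<and> \<not> 3 dvd (a + b + c)"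
  using assms
proof (induction "nat m" arbitrary: m a b c rule: less_induct)
  case less
  note m = \<open>m = a\<^sup>2 + b\<^sup>2 + c\<^sup>2\<close>
  have *: ?case if "m = a\<^sup>2 + b\<^sup>2 + c\<^sup>2" "\<not> 3 dvd c" for a b c
  proof -
    \<comment> \<open>The two sums differ by 2c, so a change of sign of c suffices.\<close>
    have "\<not> 3 dvd (a + b + c) \<or> \<not> 3 dvd (a + b + - c)" using that(2) by presburger
    moreover have "m = a\<^sup>2 + b\<^sup>2 + (- c)\<^sup>2" "\<not> 3 dvd - c" using that by simp_all
    ultimately show ?thesis using that by blast
  qed
  consider "\<not> 3 dvd c" | "\<not> 3 dvd b" | "\<not> 3 dvd a" | "3 dvd a" "3 dvd b" "3 dvd c" by blast
  thus ?case
  proof cases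
    case 1
    thus ?thesis using * m by blast
  next
    case 2
    thus ?thesis using *[of a c b] m by simp
  next
    case 3
    thus ?thesis using *[of b c a] m by simp
  next
    case 4
    then obtain p q r where pqr: "a = 3 * p" "b = 3 * q" "c = 3 * r" by blast
    define k where "k = p\<^sup>2 + q\<^sup>2 + r\<^sup>2"
    have m9: "m = 9 * k" by (simp add: m pqr k_def power2_eq_square)
    hence "nat k < nat m" "k > 0" using less.prems(1) by auto
    from less.hyps[OF this k_def] obtain a b c where abc: "k = a\<^sup>2 + b\<^sup>2 + c\<^sup>2" "\<not> 3 dvd (a + b + c)" by blast
    define s where "s = a + b + c"
    have "m = (3 * a - 2 * s)\<^sup>2 + (3 * b - 2 * s)\<^sup>2 + (3 * c - 2 * s)\<^sup>2"
      by (simp add: m9 abc(1) s_def power2_eq_square algebra_simps)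
    moreover have "\<not> 3 dvd (3 * c - 2 * s)" using abc(2) unfolding s_def[symmetric] by presburger
    ultimately show ?thesis by (rule *)
  qed
qed

text \<open>The orthogonal vectors (1, 1, -2), (1, 1, 1), (1, -1, 0) have norms 6, 3, 2, so 6 (a^2 +
  b^2 + c^2) becomes a form with coefficients 1, 2, 3. Modulo 3 the first coordinate agrees with a +
  b + c.\<close>

lemma unit_mod_6_form_1_2_3:
  assumes "4 * int n + 1 = qform 0 x y z"
  shows "\<exists>u v w. 24 * int n + 6 = u\<^sup>2 + 2 * v\<^sup>2 + 3 * w\<^sup>2 \<and> unit_mod_6 u \<and> unit_mod_6 v \<and> unit_mod_6 w"
proof -
  have "4 * int n + 1 > 0" "4 * int n + 1 = x\<^sup>2 + y\<^sup>2 + z\<^sup>2" using assms by (simp_all add: qform_def)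
  from sum_three_squares_not_dvd_3[OF this] obtain a b c where
    abc: "4 * int n + 1 = a\<^sup>2 + b\<^sup>2 + c\<^sup>2" "\<not> 3 dvd (a + b + c)" by blast
  define v where "v = a + b + c"
  have "24 * int n + 6 = 6 * (a\<^sup>2 + b\<^sup>2 + c\<^sup>2)" using abc(1) by simp
  hence eq: "24 * int n + 6 = (a + b - 2 * c)\<^sup>2 + 2 * v\<^sup>2 + 3 * (a - b)\<^sup>2"
    by (simp add: v_def power2_eq_square algebra_simps)
  have "odd (a\<^sup>2 + b\<^sup>2 + c\<^sup>2)" unfolding abc(1)[symmetric] by simp
  hence "odd v" by (simp add: v_def)
  then obtain j where "v\<^sup>2 = 8 * j + 1" using odd_squareE by blast
  hence "((a + b - 2 * c)\<^sup>2 + 3 * (a - b)\<^sup>2) mod 8 = 4"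
    using eq by (intro mod_eqI[of _ _ "3 * int n - 2 * j"]) simp_all
  moreover have "\<not> 3 dvd (a + b - 2 * c)" using abc(2) by presburger
  ultimately obtain u w where "unit_mod_6 u" "unit_mod_6 w" "u\<^sup>2 + 3 * w\<^sup>2 = (a + b - 2 * c)\<^sup>2 + 3 * (a - b)\<^sup>2"
    using square_plus_three_squares_units by blast
  moreover have "unit_mod_6 v" using \<open>odd v\<close> abc(2) by (simp add: unit_mod_6_def v_def)
  moreover have "24 * int n + 6 = u\<^sup>2 + 2 * v\<^sup>2 + 3 * w\<^sup>2" using eq calculation(3) by linarith
  ultimately show ?thesis by blast
qed

text \<open>The same orthogonal vectors, scaled by 3 instead of 6: u = a + b + c, v = (a + b)/2 - c
  and w = (a - b)/2.\<close>

lemma unit_mod_6_form_1_2_6: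
  assumes "8 * int n + 3 = qform 0 x y z"
  shows "\<exists>u v w. 24 * int n + 9 = u\<^sup>2 + 2 * v\<^sup>2 + 6 * w\<^sup>2 \<and> unit_mod_6 u \<and> unit_mod_6 v \<and> unit_mod_6 w"
proof -
  have "8 * int n + 3 > 0" "8 * int n + 3 = x\<^sup>2 + y\<^sup>2 + z\<^sup>2" using assms by (simp_all add: qform_def)
  from sum_three_squares_not_dvd_3[OF this] obtain a b0 c0 where
    abc0: "8 * int n + 3 = a\<^sup>2 + b0\<^sup>2 + c0\<^sup>2" "\<not> 3 dvd c0" by blast
  have odd: "odd a" "odd b0" "odd c0" using sum_three_squares_mod_8_eq_3[OF abc0(1)[symmetric]] by blast+
  \<comment> \<open>With a + b divisible by 4, (a + b)/2 is even and (a - b)/2 is odd, so v and w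
    both come out odd.\<close>
  have "4 dvd a + b0 \<or> 4 dvd a + - b0" using odd by presburger
  then obtain b where b: "b = b0 \<or> b = - b0" "4 dvd a + b" by blast
  have "\<not> 3 dvd (a + b + c0) \<or> \<not> 3 dvd (a + b + - c0)" using abc0(2) by presburger
  then obtain c where c: "c = c0 \<or> c = - c0" "\<not> 3 dvd (a + b + c)" by blast
  have abc: "8 * int n + 3 = a\<^sup>2 + b\<^sup>2 + c\<^sup>2" using abc0(1) b(1) c(1) by auto
  have "odd b" "odd c" using odd b(1) c(1) by auto
  obtain k where k: "b = 4 * k - a" using b(2) by (metis add_diff_cancel_left' dvd_def)
  define u v w where "u = 4 * k + c" "v = 2 * k - c" "w = a - 2 * k"
  have "24 * int n + 9 = 3 * (a\<^sup>2 + b\<^sup>2 + c\<^sup>2)" using abc by simp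
  hence eq: "24 * int n + 9 = u\<^sup>2 + 2 * (v\<^sup>2 + 3 * w\<^sup>2)"
    by (simp add: u_v_w_def k power2_eq_square algebra_simps)
  have "odd u" "odd v" "odd w" using \<open>odd a\<close> \<open>odd c\<close> by (simp_all add: u_v_w_def)
  have "\<not> 3 dvd u" "\<not> 3 dvd v" using c(2) unfolding u_v_w_def k by presburger+
  moreover have "(v\<^sup>2 + 3 * w\<^sup>2) mod 8 = 4"
    using odd_square_plus_three_odd_squares[OF \<open>odd v\<close> \<open>odd w\<close>] .
  ultimately obtain v' w' where vw: "unit_mod_6 v'" "unit_mod_6 w'" "v'\<^sup>2 + 3 * w'\<^sup>2 = v\<^sup>2 + 3 * w\<^sup>2"
    using square_plus_three_squares_units by blast
  have "unit_mod_6 u" using \<open>odd u\<close> \<open>\<not> 3 dvd u\<close> by (simp add: unit_mod_6_def)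
  moreover have "24 * int n + 9 = u\<^sup>2 + 2 * v'\<^sup>2 + 6 * w'\<^sup>2" using eq unfolding vw(3)[symmetric] by simp
  ultimately show ?thesis using vw by blast
qed

theorem theorem1p1:
  shows "\<forall>(b, c) \<in> {(1, 3), (2, 3), (2, 6), (3, 3), (3, 4), (3, 9)} :: (int \<times> int) set.
    \<forall>n :: nat. \<exists>x y z :: int.
      int n = polygonal 5 x + b * polygonal 5 y + c * polygonal 5 z"
proof -
  have "\<exists>x y z. int n = polygonal 5 x + b * polygonal 5 y + c * polygonal 5 z"
    if bc: "(b, c) \<in> {(1, 3), (2, 3), (2, 6), (3, 3), (3, 4), (3, 9)}" for b c :: int and n :: nat
  proof -
    have "\<exists>u v w. 24 * int n + 1 + b + c = u\<^sup>2 + b * v\<^sup>2 + c * w\<^sup>2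
        \<and> unit_mod_6 u \<and> unit_mod_6 v \<and> unit_mod_6 w"
    proof -
      consider "b = 1" "c = 3" | "b = 2" "c = 3" | "b = 2" "c = 6" | "b = 3" "c = 3"
        | "b = 3" "c = 4" | "b = 3" "c = 9" using bc by auto
      thus ?thesis
      proof cases
        case 1
        have "\<not> 3 dvd 24 * n + 5" by presburger
        then obtain x y z where "int (24 * n + 5) = qform 1 x y z" using qform_one_represents by blast
        then obtain y z where "24 * int n + 5 = x\<^sup>2 + y\<^sup>2 + 3 * z\<^sup>2"
          using qform_one_eq_square_plus_three_squares[of x y z] by auto
        from unit_mod_6_form_1_1_3[OF this] show ?thesis by (simp add: 1 add.commute)
      next
        case 2
        have "(4 * n + 1) mod 4 = 1" by presburger
        then obtain x y z where "int (4 * n + 1) = qform 0 x y z" using sum_three_squares by blast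
        hence "4 * int n + 1 = qform 0 x y z" unfolding of_nat_add of_nat_mult by simp
        from unit_mod_6_form_1_2_3[OF this] show ?thesis by (simp add: 2 add.commute)
      next
        case 3
        have "(8 * n + 3) mod 8 = 3" by presburger
        then obtain x y z where "int (8 * n + 3) = qform 0 x y z" using sum_three_squares by blast
        hence "8 * int n + 3 = qform 0 x y z" unfolding of_nat_add of_nat_mult by simp
        from unit_mod_6_form_1_2_6[OF this] show ?thesis by (simp add: 3 add.commute)
      next
        case 4
        have "(24 * n + 7) mod 6 = 1" by presburger
        then obtain x y z where "3 * int (24 * n + 7) = qform 1 x y z"
          using qform_one_represents_triple by blast
        then obtain y z where "3 * (24 * int n + 7) = x\<^sup>2 + y\<^sup>2 + 3 * z\<^sup>2"
          using qform_one_eq_square_plus_three_squares[of x y z] by auto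
        from unit_mod_6_form_1_3_3[OF this] show ?thesis by (simp add: 4 add.commute)
      next
        case 5
        have "\<not> 3 dvd 6 * n + 2" by presburger
        then obtain x y z where "int (6 * n + 2) = qform 1 x y z" using qform_one_represents by blast
        hence "6 * int n + 2 = qform 1 x y z" by simp
        from unit_mod_6_form_1_3_4[OF this] show ?thesis by (simp add: 5 add.commute)
      next
        case 6
        have "\<not> 3 dvd 24 * n + 13" by presburger
        then obtain x y z where "int (24 * n + 13) = qform 1 x y z" using qform_one_represents by blast
        then obtain y z where "24 * int n + 13 = x\<^sup>2 + y\<^sup>2 + 3 * z\<^sup>2"
          using qform_one_eq_square_plus_three_squares[of x y z] by auto
        from unit_mod_6_form_1_3_9[OF this] show ?thesis by (simp add: 6 add.commute)
      qed
    qed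
    thus ?thesis using pentagonal_sum_of_squares by blast
  qed
  thus ?thesis by blast
qed

end
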